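(* Let $\varphi:\mathbb{R}^n\to\mathbb{R}$ be of class $\mathcal{C}^{1,1}$ and let $x^0\in\mathbb{R}^n$ be such that $\partial^2\varphi(x)$ is positive-definite (i.e. $\langle z,u\rangle>0$ for all $u\ne0$, $z\in\partial^2\varphi(x)(u)$) for every $x$ in $\Omega:=\{x\mid\varphi(x)\le\varphi(x^0)\}$. Let $\{x^k\}$ be generated by the Generalized Damped Newton Algorithm with parameters $\sigma\in(0,\tfrac12)$, $\beta\in(0,1)$ from $x^0$, and suppose $x^k\to\bar x$ with $x^k\ne\bar x$ for all $k$, that $\nabla\varphi$ is locally Lipschitzian around $\bar x$ with constant $\ell>0$, and that $\nabla\varphi$ is semismooth$^*$ at $\bar x$. Then the convergence of $\{x^k\}$ to $\bar x$ is at least Q-superlinear, i.e. $\|x^{k+1}-\bar x\|/\|x^k-\bar x\|\to0$, provided that either (i) $\nabla\varphi$ is directionally differentiable at $\bar x$, or (ii) $\sigma\in(0,1/(2\ell\kappa))$, where $\kappa>0$ is a modulus of tilt stability of $\varphi$ at $\bar x$. Moreover, in both cases (i) and (ii), $\{\varphi(x^k)\}$ converges Q-superlinearly to $\varphi(\bar x)$ and $\{\nabla\varphi(x^k)\}$ converges Q-superlinearly to $0$.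
   Context: A function $\varphi:\mathbb{R}^n\to\mathbb{R}$ is of class $\mathcal{C}^{1,1}$ if it is continuously differentiable and $\nabla\varphi$ is Lipschitz continuous around every point. Regular normal cone: $\widehat N_\Omega(\bar z):=\{v\mid \limsup_{z\to\bar z,\,z\in\Omega}\langle v,z-\bar z\rangle/\|z-\bar z\|\le 0\}$; limiting normal cone $N_\Omega(\bar z)$: all $v$ with $z_k\to\bar z$, $z_k\in\Omega$, $v_k\to v$, $v_k\in\widehat N_\Omega(z_k)$. Coderivative of $F:\mathbb{R}^n\rightrightarrows\mathbb{R}^m$: $D^*F(\bar x,\bar y)(v):=\{u\mid (u,-v)\in N_{\operatorname{gph}F}(\bar x,\bar y)\}$. For $\mathcal{C}^{1,1}$ $\varphi$: $\partial^2\varphi(x)(u):=D^*(\nabla\varphi)(x,\nabla\varphi(x))(u)$. Directional limiting normal cone: $N_\Omega(\bar z;d):=\{v\mid \exists t_k\downarrow0,\ d_k\to d,\ v_k\to v \text{ with } v_k\in\widehat N_\Omega(\bar z+t_kd_k)\}$. Directional coderivative: $D^*F((\bar x,\bar y);(u,v))(v^* ):=\{u^*\mid (u^*,-v^* )\in N_{\operatorname{gph}F}((\bar x,\bar y);(u,v))\}$. $F$ is semismooth$^*$ at $(\bar x,\bar y)\in\operatorname{gph}F$ if for all $(u,v)\in\mathbb{R}^n\times\mathbb{R}^m$ one has $\langle u^*,u\rangle=\langle v^*,v\rangle$ for all $(v^*,u^* )$ with $u^*\in D^*F((\bar x,\bar y);(u,v))(v^* )$; a single-valued map is semismooth$^*$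 at $\bar x$ if it is so at $(\bar x,\nabla\varphi(\bar x))$. Tilt stability: $\bar x$ is a tilt-stable local minimizer of $\varphi$ if there is $\gamma>0$ such that $M_\gamma(v):=\operatorname{argmin}\{\varphi(x)-\langle v,x\rangle\mid x\in\mathbb{B}_\gamma(\bar x)\}$ is single-valued and Lipschitz continuous on a neighborhood of $0$ with $M_\gamma(0)=\{\bar x\}$; a modulus of tilt stability is a Lipschitz constant of $M_\gamma$ around $0$. Generalized Damped Newton Algorithm: given $\sigma,\beta$ and $x^0$, set $k=0$. If $\nabla\varphi(x^k)=0$ stop. Otherwise choose $d^k$ with $-\nabla\varphi(x^k)\in\partial^2\varphi(x^k)(d^k)$; set $\tau_k=1$ and, while $\varphi(x^k+\tau_kd^k)>\varphi(x^k)+\sigma\tau_k\langle\nabla\varphi(x^k),d^k\rangle$, replace $\tau_k$ by $\beta\tau_k$; set $x^{k+1}:=x^k+\tau_kd^k$, increase $k$ by 1 and repeat. Q-superlinear convergence of a sequence $a_k\to\bar a$ ($a_k\ne\bar a$) means $\|a_{k+1}-\bar a\|/\|a_k-\bar a\|\to0$. *)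

theory Defs
  imports "HOL-Analysis.Analysis"
begin

definition C11 :: "('a::euclidean_space \<Rightarrow> real) \<Rightarrow> ('a \<Rightarrow> 'a) \<Rightarrow> bool" where
  "C11 \<phi> g \<longleftrightarrow> (\<forall>x. (\<phi> has_derivative (\<lambda>h. g x \<bullet> h)) (at x))
     \<and> continuous_on UNIV g
     \<and> (\<forall>x. \<exists>\<delta>>0. \<exists>L. \<forall>y\<in>ball x \<delta>. \<forall>z\<in>ball x \<delta>. dist (g y) (g z) \<le> L * dist y z)"

definition reg_normal_cone :: "'a::euclidean_space set \<Rightarrow> 'a \<Rightarrow> 'a set" where
  "reg_normal_cone \<Omega> zb = {v. zb \<in> \<Omega> \<and>
     Limsup (at zb within \<Omega>) (\<lambda>z. ereal ((v \<bullet> (z - zb)) / norm (z - zb))) \<le> 0}"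

definition lim_normal_cone :: "'a::euclidean_space set \<Rightarrow> 'a \<Rightarrow> 'a set" where
  "lim_normal_cone \<Omega> zb = {v. \<exists>z vs :: nat \<Rightarrow> 'a. (\<forall>k. z k \<in> \<Omega>) \<and> z \<longlonglongrightarrow> zb
     \<and> vs \<longlonglongrightarrow> v \<and> (\<forall>k. vs k \<in> reg_normal_cone \<Omega> (z k))}"

definition dir_normal_cone :: "'a::euclidean_space set \<Rightarrow> 'a \<Rightarrow> 'a \<Rightarrow> 'a set" where
  "dir_normal_cone \<Omega> zb d = {v. \<exists>(t :: nat \<Rightarrow> real) (ds :: nat \<Rightarrow> 'a) (vs :: nat \<Rightarrow> 'a).
     (\<forall>k. t k > 0) \<and> t \<longlonglongrightarrow> 0 \<and> ds \<longlonglongrightarrow> d \<and> vs \<longlonglongrightarrow> v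
     \<and> (\<forall>k. vs k \<in> reg_normal_cone \<Omega> (zb + t k *\<^sub>R ds k))}"

definition graph :: "('a \<Rightarrow> 'b set) \<Rightarrow> ('a \<times> 'b) set" where
  "graph F = {(x, y). y \<in> F x}"

definition coderiv :: "('a::euclidean_space \<Rightarrow> 'b::euclidean_space set) \<Rightarrow> 'a \<Rightarrow> 'b \<Rightarrow> 'b \<Rightarrow> 'a set" where
  "coderiv F xb yb v = {u. (u, - v) \<in> lim_normal_cone (graph F) (xb, yb)}"

definition dir_coderiv :: "('a::euclidean_space \<Rightarrow> 'b::euclidean_space set) \<Rightarrow> 'a \<Rightarrow> 'b \<Rightarrow> 'a \<Rightarrow> 'b \<Rightarrow> 'b \<Rightarrow> 'a set" where
  "dir_coderiv F xb yb u v vs = {us. (us, - vs) \<in> dir_normal_cone (graph F) (xb, yb) (u, v)}"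

definition hess2 :: "('a::euclidean_space \<Rightarrow> 'a) \<Rightarrow> 'a \<Rightarrow> 'a \<Rightarrow> 'a set" where
  "hess2 g x u = coderiv (\<lambda>y. {g y}) x (g x) u"

definition semismooth_star :: "('a::euclidean_space \<Rightarrow> 'b::euclidean_space set) \<Rightarrow> 'a \<Rightarrow> 'b \<Rightarrow> bool" where
  "semismooth_star F xb yb \<longleftrightarrow> (\<forall>u v vs us. us \<in> dir_coderiv F xb yb u v vs \<longrightarrow> us \<bullet> u = vs \<bullet> v)"

definition semismooth_star_fun :: "('a::euclidean_space \<Rightarrow> 'b::euclidean_space) \<Rightarrow> 'a \<Rightarrow> bool" where
  "semismooth_star_fun G xb \<longleftrightarrow> semismooth_star (\<lambda>y. {G y}) xb (G xb)"

definition tilt_argmin :: "('a::euclidean_space \<Rightarrow> real) \<Rightarrow> 'a \<Rightarrow> real \<Rightarrow> 'a \<Rightarrow> 'a set" where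
  "tilt_argmin \<phi> xb \<gamma> v = {x \<in> cball xb \<gamma>. \<forall>y\<in>cball xb \<gamma>. \<phi> x - v \<bullet> x \<le> \<phi> y - v \<bullet> y}"

definition tilt_modulus :: "('a::euclidean_space \<Rightarrow> real) \<Rightarrow> 'a \<Rightarrow> real \<Rightarrow> bool" where
  "tilt_modulus \<phi> xb \<kappa> \<longleftrightarrow> (\<exists>\<gamma>>0. \<exists>\<epsilon>>0. \<exists>m :: 'a \<Rightarrow> 'a.
      tilt_argmin \<phi> xb \<gamma> 0 = {xb}
    \<and> (\<forall>v\<in>ball 0 \<epsilon>. tilt_argmin \<phi> xb \<gamma> v = {m v})
    \<and> (\<forall>v\<in>ball 0 \<epsilon>. \<forall>w\<in>ball 0 \<epsilon>. dist (m v) (m w) \<le> \<kappa> * dist v w))"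

definition armijo :: "('a::euclidean_space \<Rightarrow> real) \<Rightarrow> ('a \<Rightarrow> 'a) \<Rightarrow> real \<Rightarrow> real \<Rightarrow> 'a \<Rightarrow> 'a \<Rightarrow> nat \<Rightarrow> bool" where
  "armijo \<phi> g \<sigma> \<beta> x d j \<longleftrightarrow> \<phi> (x + (\<beta> ^ j) *\<^sub>R d) \<le> \<phi> x + \<sigma> * \<beta> ^ j * (g x \<bullet> d)"

text \<open>x is an (infinite, non-terminating) run of the Generalized Damped Newton Algorithm:
  tau_k = beta^j with j the first index for which backtracking stops.\<close>
definition gdna_seq :: "('a::euclidean_space \<Rightarrow> real) \<Rightarrow> ('a \<Rightarrow> 'a) \<Rightarrow> real \<Rightarrow> real \<Rightarrow> (nat \<Rightarrow> 'a) \<Rightarrow> bool" where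
  "gdna_seq \<phi> g \<sigma> \<beta> x \<longleftrightarrow> (\<forall>k. g (x k) \<noteq> 0 \<and>
     (\<exists>d j. - g (x k) \<in> hess2 g (x k) d \<and> armijo \<phi> g \<sigma> \<beta> (x k) d j
        \<and> (\<forall>i<j. \<not> armijo \<phi> g \<sigma> \<beta> (x k) d i)
        \<and> x (Suc k) = x k + (\<beta> ^ j) *\<^sub>R d))"

definition q_superlinear :: "(nat \<Rightarrow> 'b::real_normed_vector) \<Rightarrow> 'b \<Rightarrow> bool" where
  "q_superlinear a ab \<longleftrightarrow> a \<longlonglongrightarrow> ab \<and> (\<forall>k. a k \<noteq> ab)
     \<and> (\<lambda>k. norm (a (Suc k) - ab) / norm (a k - ab)) \<longlonglongrightarrow> 0"

definition dir_differentiable :: "('a::euclidean_space \<Rightarrow> 'b::euclidean_space) \<Rightarrow> 'a \<Rightarrow> bool" where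
  "dir_differentiable G xb \<longleftrightarrow> (\<forall>d. \<exists>L. ((\<lambda>t. (G (xb + t *\<^sub>R d) - G xb) /\<^sub>R t) \<longlongrightarrow> L) (at_right 0))"

end

theory Submission
  imports Defs
begin

text \<open>
  Call \<open>z\<close> a \<^emph>\<open>regular subgradient\<close> of \<open>\<langle>u, g\<rangle>\<close> at \<open>y\<close> if \<open>(z, - u)\<close> is a regular normal to the
  graph of \<open>g\<close> at \<open>(y, g y)\<close>; the elements of \<open>hess2 g x u\<close> are limits of these.
  By compactness, positive definiteness at the limit point and semismoothness* become
  estimates for regular subgradients, uniform near the limit point \<open>xb\<close>:
  \<open>\<langle>z, u\<rangle> \<ge> c |u|\<^sup>2\<close> and \<open>\<langle>z, y - xb\<rangle> = \<langle>u, g y - g xb\<rangle> + o(|y - xb| |u|)\<close>.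

  The symmetry of Hessians enters without second derivatives existing anywhere: if every regular
  subgradient \<open>\<zeta>\<close> of \<open>\<langle>w, g\<rangle>\<close> near \<open>p\<close> satisfies \<open>\<langle>\<zeta>, d\<rangle> \<le> \<alpha>\<close>, then \<open>\<langle>z, w\<rangle> \<le> \<alpha>\<close> for every
  \<open>z \<in> hess2 g p d\<close>. A mean value inequality turns the bound on subgradients into one on
  the increments of \<open>\<langle>w, g\<rangle>\<close> along \<open>d\<close>, and mixed second differences of \<open>\<phi>\<close>, being symmetric, turn it
  into a bound on the increments of \<open>\<langle>d, g\<rangle>\<close> along \<open>w\<close>. With \<open>- g p \<in> hess2 g p d\<close> and
  \<open>w = - (p + d - xb)\<close> the two uniform estimates give \<open>c |w|\<^sup>2 \<le> o(|p - xb|) |w|\<close>, so full Newton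
  steps are superlinear.

  Full steps are eventually accepted because
  \<open>\<phi> y - \<phi> xb \<ge> \<sigma> \<langle>g y, y - xb\<rangle> + \<mu> |y - xb|\<^sup>2\<close> near \<open>xb\<close> for some \<open>\<mu> > 0\<close>. Under directional
  differentiability \<open>\<phi> y - \<phi> xb = \<langle>g y, y - xb\<rangle> / 2 + o(|y - xb|\<^sup>2)\<close>; under tilt stability
  \<open>\<phi> y - \<phi> xb \<ge> |y - xb|\<^sup>2 / (2 \<kappa>)\<close>.
\<close>

subsection \<open>Regular subgradients\<close>

text \<open>The Frechet (regular) subdifferential of a real function in epsilon-delta form.
  Multiplying out the quotient removes the exceptional case \<open>h = 0\<close> and leaves a
  one-sided inequality that combines well with minimisation.\<close>

definition reg_subgrad :: "('a::euclidean_space \<Rightarrow> real) \<Rightarrow> 'a \<Rightarrow> 'a \<Rightarrow> bool" where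
  "reg_subgrad f y z \<longleftrightarrow> (\<forall>\<epsilon>>0. \<exists>\<delta>>0. \<forall>h. norm h < \<delta> \<longrightarrow> f y + z \<bullet> h - \<epsilon> * norm h \<le> f (y + h))"

lemma reg_subgrad_scale:
  assumes "reg_subgrad f y z" and "c > 0"
  shows "reg_subgrad (\<lambda>x. c * f x) y (c *\<^sub>R z)"
  unfolding reg_subgrad_def
proof (intro allI impI)
  fix \<epsilon> :: real assume "\<epsilon> > 0"
  then have "\<epsilon> / c > 0" using assms by simp
  then obtain \<delta> where d: "\<delta> > 0" "\<And>h. norm h < \<delta> \<Longrightarrow> f y + z \<bullet> h - \<epsilon> / c * norm h \<le> f (y + h)"
    using assms(1) unfolding reg_subgrad_def by meson
  have "c * f y + c *\<^sub>R z \<bullet> h - \<epsilon> * norm h \<le> c * f (y + h)" if "norm h < \<delta>" for h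
  proof -
    have "c * (f y + z \<bullet> h - \<epsilon> / c * norm h) \<le> c * f (y + h)"
      using d(2)[OF that] assms(2) by simp
    then show ?thesis using assms(2) by (simp add: algebra_simps)
  qed
  then show "\<exists>\<delta>>0. \<forall>h. norm h < \<delta> \<longrightarrow> c * f y + c *\<^sub>R z \<bullet> h - \<epsilon> * norm h \<le> c * f (y + h)"
    using d(1) by blast
qed

text \<open>Insert \<open>h = s *\<^sub>R w\<close> in the definition, divide by \<open>s\<close>
  and let it shrink. This turns bounds on increments into bounds on subgradients.\<close>

lemma reg_subgrad_inner_le:
  assumes z: "reg_subgrad f y z" and "\<delta> > 0"
    and le: "\<And>s. 0 < s \<Longrightarrow> s < \<delta> \<Longrightarrow> f (y + s *\<^sub>R w) - f y \<le> s * \<alpha>"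
  shows "z \<bullet> w \<le> \<alpha>"
proof (rule field_le_epsilon)
  fix e :: real assume "e > 0"
  define e' where "e' = e / (norm w + 1)"
  have e': "e' > 0" "e' * norm w \<le> e"
    using \<open>e > 0\<close> by (auto simp: e'_def field_simps add_pos_nonneg)
  then obtain r where r: "r > 0" "\<And>h. norm h < r \<Longrightarrow> f y + z \<bullet> h - e' * norm h \<le> f (y + h)"
    using z unfolding reg_subgrad_def by meson
  \<comment> \<open>The first bound keeps \<open>s\<close> below \<open>\<delta>\<close>, the second
    keeps \<open>s *\<^sub>R w\<close> inside radius \<open>r\<close>; the added 1 covers
    \<open>w = 0\<close>.\<close>
  define s where "s = min (\<delta> / 2) (r / (2 * (norm w + 1)))"
  have nw: "norm w + 1 > 0" by (simp add: add_nonneg_pos)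
  have s: "0 < s" "s < \<delta>" using \<open>\<delta> > 0\<close> r(1) nw by (auto simp: s_def)
  have "s * norm w \<le> r / (2 * (norm w + 1)) * norm w"
    by (intro mult_right_mono) (auto simp: s_def)
  also have "\<dots> < r" using nw r(1) by (simp add: field_simps add_pos_nonneg add_nonneg_pos)
  finally have "norm (s *\<^sub>R w) < r" using s by simp
  from r(2)[OF this] le[OF s] have "s * (z \<bullet> w) - e' * (s * norm w) \<le> s * \<alpha>" using s by simp
  then have "s * (z \<bullet> w - e' * norm w) \<le> s * \<alpha>" by (simp add: algebra_simps)
  then have "z \<bullet> w - e' * norm w \<le> \<alpha>" using s by simp
  then show "z \<bullet> w \<le> \<alpha> + e" using e' by linarith
qed

text \<open>A displacement along the graph has norm between \<open>norm h\<close> and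
  \<open>(1 + \<bar>L\<bar>) * norm h\<close>, so errors that are small relative to one are small
  relative to the other. The Lipschitz bound serves the direction from normals to
  subgradients.\<close>

lemma reg_normal_cone_graph_iff:
  fixes g :: "'a::euclidean_space \<Rightarrow> 'b::euclidean_space"
  assumes "\<delta> > 0" and lip: "\<And>z. z \<in> ball y \<delta> \<Longrightarrow> norm (g z - g y) \<le> L * norm (z - y)"
  shows "(z, - u) \<in> reg_normal_cone (graph (\<lambda>x. {g x})) (y, g y) \<longleftrightarrow> reg_subgrad (\<lambda>x. u \<bullet> g x) y z"
    (is "?N \<longleftrightarrow> ?S")
proof -
  let ?G = "graph (\<lambda>x. {g x})"
  let ?q = "\<lambda>p. ((z, - u) \<bullet> (p - (y, g y))) / norm (p - (y, g y))"
  have "?N \<longleftrightarrow> Limsup (at (y, g y) within ?G) (\<lambda>p. ereal (?q p)) \<le> 0"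
    by (simp add: reg_normal_cone_def graph_def)
  also have "\<dots> \<longleftrightarrow> (\<forall>e>0. eventually (\<lambda>p. ?q p < e) (at (y, g y) within ?G))"
  proof
    assume a: "Limsup (at (y, g y) within ?G) (\<lambda>p. ereal (?q p)) \<le> 0"
    have "eventually (\<lambda>p. ereal (?q p) < ereal e) (at (y, g y) within ?G)" if "e > 0" for e
      using a[unfolded Limsup_le_iff, rule_format, of "ereal e"] that by simp
    then show "\<forall>e>0. eventually (\<lambda>p. ?q p < e) (at (y, g y) within ?G)"
      by simp
  next
    assume a: "\<forall>e>0. eventually (\<lambda>p. ?q p < e) (at (y, g y) within ?G)"
    show "Limsup (at (y, g y) within ?G) (\<lambda>p. ereal (?q p)) \<le> 0"
      unfolding Limsup_le_iff
    proof (intro allI impI)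
      fix c :: ereal assume "0 < c"
      then obtain e where e: "0 < ereal e" "ereal e < c" using ereal_dense2 by blast
      have "eventually (\<lambda>p. ?q p < e) (at (y, g y) within ?G)" using a e(1) by simp
      then show "eventually (\<lambda>p. ereal (?q p) < c) (at (y, g y) within ?G)"
        by eventually_elim (use e(2) in \<open>meson less_ereal.simps(1) less_trans\<close>)
    qed
  qed
  also have "\<dots> \<longleftrightarrow> ?S"
  proof
    assume a: "\<forall>e>0. eventually (\<lambda>p. ?q p < e) (at (y, g y) within ?G)"
    show ?S unfolding reg_subgrad_def
    proof (intro allI impI)
      fix \<epsilon> :: real assume "\<epsilon> > 0"
      define M where "M = 1 + \<bar>L\<bar>"
      have M: "M \<ge> 1" by (simp add: M_def)
      \<comment> \<open>The tolerance is divided by \<open>M\<close> because the graph displacement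
        may exceed \<open>norm h\<close> by that factor.\<close>
      have "\<epsilon> / M > 0" using \<open>\<epsilon> > 0\<close> M by simp
      with a obtain r where r: "r > 0"
        "\<And>p. p \<in> ?G \<Longrightarrow> p \<noteq> (y, g y) \<Longrightarrow> dist p (y, g y) < r \<Longrightarrow> ?q p < \<epsilon> / M"
        unfolding eventually_at by meson
      define s where "s = min \<delta> (r / M)"
      have s: "s > 0" using r M \<open>\<delta> > 0\<close> by (simp add: s_def)
      have "u \<bullet> g y + z \<bullet> h - \<epsilon> * norm h \<le> u \<bullet> g (y + h)" if h: "norm h < s" for h
      proof (cases "h = 0")
        case False
        let ?p = "(y + h, g (y + h))"
        have "y + h \<in> ball y \<delta>" using h by (simp add: s_def dist_norm)
        then have "norm (g (y + h) - g y) \<le> L * norm h" using lip[of "y + h"] by simp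
        also have "\<dots> \<le> \<bar>L\<bar> * norm h" by (intro mult_right_mono) auto
        finally have gb: "norm (g (y + h) - g y) \<le> \<bar>L\<bar> * norm h" .
        have n: "norm (?p - (y, g y)) \<le> M * norm h"
          using norm_Pair_le[of h "g (y + h) - g y"] gb by (simp add: M_def algebra_simps)
        have "M * norm h < r" using h M by (simp add: s_def field_simps)
        then have "dist ?p (y, g y) < r" using n unfolding dist_norm by linarith
        then have "?q ?p < \<epsilon> / M" using r(2)[of ?p] False by (simp add: graph_def)
        moreover have np: "norm (?p - (y, g y)) > 0" using False by (simp add: zero_prod_def)
        ultimately have "(z, - u) \<bullet> (?p - (y, g y)) < \<epsilon> / M * norm (?p - (y, g y))"
          by (simp only: pos_divide_less_eq)
        also have "\<dots> \<le> \<epsilon> / M * (M * norm h)"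
          using n \<open>\<epsilon> / M > 0\<close> by (intro mult_left_mono) auto
        also have "\<dots> = \<epsilon> * norm h" using M by simp
        finally show ?thesis by (simp add: inner_diff_right)
      qed simp
      then show "\<exists>\<delta>>0. \<forall>h. norm h < \<delta> \<longrightarrow> u \<bullet> g y + z \<bullet> h - \<epsilon> * norm h \<le> u \<bullet> g (y + h)"
        using s by blast
    qed
  next
    assume S: ?S
    show "\<forall>e>0. eventually (\<lambda>p. ?q p < e) (at (y, g y) within ?G)"
    proof (intro allI impI)
      fix e :: real assume "e > 0"
      then have "e / 2 > 0" by simp
      with S obtain r where r: "r > 0"
        "\<And>h. norm h < r \<Longrightarrow> u \<bullet> g y + z \<bullet> h - e / 2 * norm h \<le> u \<bullet> g (y + h)"
        unfolding reg_subgrad_def by meson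
      have "?q p < e" if p: "p \<in> ?G" "p \<noteq> (y, g y)" "dist p (y, g y) < r" for p
      proof -
        obtain x where x: "p = (x, g x)" using p(1) by (auto simp: graph_def)
        have n: "norm (x - y) \<le> norm (p - (y, g y))"
          using norm_fst_le[of "x - y" "g x - g y"] by (simp add: x)
        then have "norm (x - y) < r" using p(3) by (simp add: dist_norm)
        from r(2)[OF this] have "(z, - u) \<bullet> (p - (y, g y)) \<le> e / 2 * norm (x - y)"
          by (simp add: x inner_diff_right)
        also have "\<dots> \<le> e / 2 * norm (p - (y, g y))" using n \<open>e > 0\<close> by (intro mult_left_mono) auto
        also have "\<dots> < e * norm (p - (y, g y))" using p(2) \<open>e > 0\<close> by simp
        finally show ?thesis using p(2) by (simp add: pos_divide_less_eq)
      qed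
      then show "eventually (\<lambda>p. ?q p < e) (at (y, g y) within ?G)"
        unfolding eventually_at using r(1) by blast
    qed
  qed
  finally show ?thesis .
qed

text \<open>
  If the increment exceeded \<open>\<alpha>\<close>, subtracting its mean slope \<open>r\<close> along the segment leaves a minimum before
  the right end point. Replacing the constraint \<open>y = a + s v\<close> by the penalty \<open>n |y - a - s v|\<^sup>2\<close>
  produces a nearby minimiser \<open>(y, s)\<close>, at which the penalty term yields a regular subgradient of \<open>f\<close> with slope
  along \<open>v\<close> close to \<open>r\<close>.
\<close>

lemma increment_le_if_reg_subgrad_le:
  fixes f :: "'a::euclidean_space \<Rightarrow> real"
  assumes cont: "continuous_on S f" and S: "open S" "convex S" and a: "a \<in> S" "a + v \<in> S"
    and sub: "\<And>y z. y \<in> S \<Longrightarrow> reg_subgrad f y z \<Longrightarrow> z \<bullet> v \<le> \<alpha>"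
  shows "f (a + v) - f a \<le> \<alpha>"
proof (rule ccontr)
  define r where "r = f (a + v) - f a"
  assume "\<not> ?thesis"
  then have r: "r > \<alpha>" by (simp add: r_def)
  have seg: "a + s *\<^sub>R v \<in> S" if "s \<in> {0..1}" for s
    using convexD_alt[OF S(2) a, of s] that by (simp add: algebra_simps)
  define \<psi> where "\<psi> s = f (a + s *\<^sub>R v) - r * s" for s
  have "continuous_on {0..1} \<psi>"
    unfolding \<psi>_def
    by (intro continuous_intros continuous_on_compose2[OF cont]) (use seg in auto)
  then obtain s1 where s1: "s1 \<in> {0..1}" "\<And>s. s \<in> {0..1} \<Longrightarrow> \<psi> s1 \<le> \<psi> s"
    using continuous_attains_inf[of "{0..1::real}" \<psi>] by auto
  \<comment> \<open>The end points give equal values of \<open>\<psi>\<close>, so a minimum at 1 can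
    be moved to 0. Having \<open>s0 < 1\<close> leaves room to increase \<open>s\<close>
    later.\<close>
  define s0 where "s0 = (if s1 = 1 then 0 else s1)"
  have "\<psi> 0 = \<psi> 1" by (simp add: \<psi>_def r_def)
  then have s0: "0 \<le> s0" "s0 < 1" "\<And>s. s \<in> {0..1} \<Longrightarrow> \<psi> s0 \<le> \<psi> s"
    using s1 by (auto simp: s0_def)
  define p where "p = a + s0 *\<^sub>R v"
  have "p \<in> S" using seg s0 by (auto simp: p_def)
  then obtain \<eta> where eta: "\<eta> > 0" "cball p \<eta> \<subseteq> S" using S(1) open_contains_cball by blast
  let ?C = "cball p \<eta> \<times> {0..1::real}"
  \<comment> \<open>Besides the penalty, the term \<open>(snd q - s0)\<^sup>2\<close> singles out
    \<open>s0\<close> among possibly several minimisers of \<open>\<psi>\<close>, so that limits of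
    minimisers can only be \<open>(p, s0)\<close>.\<close>
  define F where "F n q = f (fst q) - r * snd q + real n * (norm (fst q - a - snd q *\<^sub>R v))\<^sup>2 + (snd q - s0)\<^sup>2"
    for n and q :: "'a \<times> real"
  have C: "compact ?C" "?C \<noteq> {}" using eta by (auto intro!: compact_Times)
  have cf: "continuous_on ?C (\<lambda>q. f (fst q))"
    by (rule continuous_on_compose2[OF cont]) (use eta in \<open>auto intro!: continuous_intros\<close>)
  have "continuous_on ?C (F n)" for n
    unfolding F_def by (intro continuous_intros cf)
  then have "\<exists>q\<in>?C. \<forall>q'\<in>?C. F n q \<le> F n q'" for n
    by (intro continuous_attains_inf C)
  then obtain q where q: "\<And>n. q n \<in> ?C" "\<And>n q'. q' \<in> ?C \<Longrightarrow> F n (q n) \<le> F n q'"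
    by metis
  obtain qs k where qs: "qs \<in> ?C" "strict_mono k" "(q \<circ> k) \<longlonglongrightarrow> qs"
    using C(1) q(1) unfolding compact_def by metis
  have cr: "continuous_on ?C (\<lambda>q. f (fst q) - r * snd q)"
    by (intro continuous_intros cf)
  obtain B where B: "\<And>q. q \<in> ?C \<Longrightarrow> B \<le> f (fst q) - r * snd q"
    using continuous_attains_inf[OF C cr] by metis
  \<comment> \<open>Comparison with \<open>(p, s0)\<close>, where both the penalty and the
    localising term vanish. With the lower bound \<open>B\<close> this forces the squared constraint
    violation to be of order \<open>1 / n\<close>.\<close>
  have up: "F n (q n) \<le> \<psi> s0" for n
    using q(2)[of "(p, s0)" n] s0 eta by (simp add: F_def \<psi>_def p_def)
  let ?g = "\<lambda>q::'a \<times> real. (norm (fst q - a - snd q *\<^sub>R v))\<^sup>2"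
  have l1: "(\<lambda>n. ?g (q (k n))) \<longlonglongrightarrow> ?g qs"
    using qs(3) unfolding o_def by (intro tendsto_intros)
  have l2: "(\<lambda>n. ?g (q (k n))) \<longlonglongrightarrow> 0"
  proof (rule tendsto_sandwich)
    show "eventually (\<lambda>n. 0 \<le> ?g (q (k n))) sequentially" by simp
    show "eventually (\<lambda>n. ?g (q (k n)) \<le> (\<psi> s0 - B) / real n) sequentially"
      using eventually_gt_at_top[of 0]
    proof eventually_elim
      case (elim n)
      have "real n * ?g (q (k n)) \<le> real (k n) * ?g (q (k n))"
        using seq_suble[OF qs(2), of n] by (intro mult_right_mono) auto
      also have "\<dots> \<le> \<psi> s0 - B"
      proof -
        have "0 \<le> (snd (q (k n)) - s0)\<^sup>2" by simp
        then show ?thesis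
          using up[of "k n"] B[OF q(1)[of "k n"]] unfolding F_def by linarith
      qed
      finally show ?case using elim by (simp add: field_simps)
    qed
    show "(\<lambda>n. (\<psi> s0 - B) / real n) \<longlonglongrightarrow> 0" by (rule lim_const_over_n)
  qed simp
  have "?g qs = 0" using LIMSEQ_unique[OF l1 l2] .
  then have fqs: "fst qs = a + snd qs *\<^sub>R v" by (simp add: algebra_simps)
  have l3: "(\<lambda>n. f (fst (q (k n))) - r * snd (q (k n)) + (snd (q (k n)) - s0)\<^sup>2)
      \<longlonglongrightarrow> f (fst qs) - r * snd qs + (snd qs - s0)\<^sup>2"
  proof -
    have "continuous_on ?C (\<lambda>q. f (fst q) - r * snd q + (snd q - s0)\<^sup>2)"
      by (intro continuous_intros cf)
    from continuous_on_tendsto_compose[OF this, of "q \<circ> k" qs sequentially] qs q(1)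
    show ?thesis by (simp add: o_def)
  qed
  have "f (fst qs) - r * snd qs + (snd qs - s0)\<^sup>2 \<le> \<psi> s0"
  proof (rule LIMSEQ_le_const2[OF l3], intro exI allI impI)
    fix n
    have "0 \<le> real (k n) * ?g (q (k n))" by simp
    then show "f (fst (q (k n))) - r * snd (q (k n)) + (snd (q (k n)) - s0)\<^sup>2 \<le> \<psi> s0"
      using up[of "k n"] unfolding F_def by linarith
  qed
  moreover have "\<psi> s0 \<le> f (fst qs) - r * snd qs"
    using s0(3)[of "snd qs"] qs(1) fqs unfolding \<psi>_def by (auto simp: mem_Times_iff)
  ultimately have "(snd qs - s0)\<^sup>2 \<le> 0" by linarith
  then have ss: "snd qs = s0" by simp
  have fs: "fst qs = p" using fqs ss by (simp add: p_def)
  have t1: "(\<lambda>n. fst (q (k n))) \<longlonglongrightarrow> p" and t2: "(\<lambda>n. snd (q (k n))) \<longlonglongrightarrow> s0"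
    using tendsto_fst[OF qs(3)] tendsto_snd[OF qs(3)] fs ss by (auto simp: o_def)
  \<comment> \<open>Late minimisers lie in the interior with respect to \<open>y\<close> and below
    the right end point with respect to \<open>s\<close>; the margin
    \<open>(r - \<alpha>) / 2\<close> yields the final contradiction.\<close>
  have "eventually (\<lambda>n. fst (q (k n)) \<in> ball p \<eta>) sequentially"
    using t1 eta(1) by (intro topological_tendstoD) auto
  moreover have "eventually (\<lambda>n. snd (q (k n)) < min 1 (s0 + (r - \<alpha>) / 2)) sequentially"
    using t2 s0 r by (intro order_tendstoD) auto
  ultimately have "eventually (\<lambda>n. fst (q (k n)) \<in> ball p \<eta> \<and> snd (q (k n)) < min 1 (s0 + (r - \<alpha>) / 2)) sequentially"
    by eventually_elim auto
  then obtain n where n: "fst (q (k n)) \<in> ball p \<eta>" "snd (q (k n)) < min 1 (s0 + (r - \<alpha>) / 2)"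
    unfolding eventually_sequentially by auto
  define N where "N = real (k n)"
  define y where "y = fst (q (k n))"
  define s where "s = snd (q (k n))"
  define w where "w = y - a - s *\<^sub>R v"
  define z where "z = (- (2 * N)) *\<^sub>R w"
  have N: "N \<ge> 0" by (simp add: N_def)
  have ys: "y \<in> ball p \<eta>" "0 \<le> s" "s < 1" "2 * (s - s0) < r - \<alpha>"
    using n q(1)[of "k n"] by (auto simp: y_def s_def mem_Times_iff field_simps)
  have min: "f y - r * s + N * (norm w)\<^sup>2 + (s - s0)\<^sup>2
      \<le> f y' - r * s' + N * (norm (y' - a - s' *\<^sub>R v))\<^sup>2 + (s' - s0)\<^sup>2"
    if "y' \<in> cball p \<eta>" "s' \<in> {0..1}" for y' s'
    using q(2)[of "(y', s')" "k n"] that unfolding F_def N_def w_def y_def s_def by simp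
  \<comment> \<open>Vary \<open>y\<close> with \<open>s\<close> fixed: \<open>f\<close> plus the
    penalty is minimal at \<open>y\<close>, so minus the gradient of the penalty, which is
    \<open>z\<close>, is a regular subgradient. The second-order remainder
    \<open>N * (norm h)\<^sup>2\<close> is absorbed by \<open>\<epsilon> * norm h\<close>.\<close>
  have "reg_subgrad f y z"
    unfolding reg_subgrad_def
  proof (intro allI impI)
    fix \<epsilon> :: real assume e: "\<epsilon> > 0"
    obtain d1 where d1: "d1 > 0" "ball y d1 \<subseteq> ball p \<eta>"
      using ys(1) open_ball open_contains_ball by metis
    define d where "d = min d1 (\<epsilon> / (N + 1))"
    have d: "d > 0" using d1 e N by (simp add: d_def)
    have "f y + z \<bullet> h - \<epsilon> * norm h \<le> f (y + h)" if h: "norm h < d" for h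
    proof -
      have "y + h \<in> ball y d1" using h by (simp add: d_def dist_norm)
      then have "y + h \<in> cball p \<eta>" using d1(2) ball_subset_cball by blast
      from min[OF this, of s] ys
      have "f y + N * (norm w)\<^sup>2 \<le> f (y + h) + N * (norm (w + h))\<^sup>2"
        by (simp add: w_def algebra_simps)
      moreover have "(norm (w + h))\<^sup>2 = (norm w)\<^sup>2 + 2 * (w \<bullet> h) + (norm h)\<^sup>2"
        by (simp add: power2_norm_eq_inner inner_add inner_commute)
      ultimately have "f y + z \<bullet> h - N * (norm h)\<^sup>2 \<le> f (y + h)"
        by (simp add: z_def algebra_simps)
      moreover have "N * (norm h)\<^sup>2 \<le> \<epsilon> * norm h"
      proof -
        have "norm h * (N + 1) \<le> \<epsilon>" using h N by (simp add: d_def field_simps)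
        then have "N * norm h + norm h \<le> \<epsilon>" by (simp add: algebra_simps)
        then have "N * norm h \<le> \<epsilon>" using norm_ge_zero[of h] by linarith
        then show ?thesis by (simp add: power2_eq_square mult_right_mono mult.assoc[symmetric])
      qed
      ultimately show ?thesis by linarith
    qed
    then show "\<exists>\<delta>>0. \<forall>h. norm h < \<delta> \<longrightarrow> f y + z \<bullet> h - \<epsilon> * norm h \<le> f (y + h)"
      using d by blast
  qed
  then have "z \<bullet> v \<le> \<alpha>" using sub ys(1) eta(2) ball_subset_cball by blast
  \<comment> \<open>Vary \<open>s\<close> upwards with \<open>y\<close> fixed, divide by the
    increment \<open>t\<close> and let it tend to 0. The term \<open>2 * (s - s0)\<close> is the
    slope of the localising term.\<close>
  moreover have "r - 2 * (s - s0) \<le> z \<bullet> v"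
  proof (rule field_le_epsilon)
    fix e :: real assume e: "e > 0"
    define t where "t = min (1 - s) (e / (N * (norm v)\<^sup>2 + 1))"
    have K: "N * (norm v)\<^sup>2 + 1 > 0" using N by (simp add: add_nonneg_pos)
    have t: "t > 0" "s + t \<le> 1" using ys e K by (auto simp: t_def)
    have "t \<le> e / (N * (norm v)\<^sup>2 + 1)" by (simp add: t_def)
    then have te: "t * (N * (norm v)\<^sup>2 + 1) \<le> e" using K by (simp only: pos_le_divide_eq)
    have "y - a - (s + t) *\<^sub>R v = w - t *\<^sub>R v" by (simp add: w_def algebra_simps)
    with min[of y "s + t"] ys t
    have "r * t \<le> N * ((norm (w - t *\<^sub>R v))\<^sup>2 - (norm w)\<^sup>2) + ((s + t - s0)\<^sup>2 - (s - s0)\<^sup>2)"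
      by (simp add: algebra_simps)
    also have "(norm (w - t *\<^sub>R v))\<^sup>2 - (norm w)\<^sup>2 = t * (t * (norm v)\<^sup>2 - 2 * (w \<bullet> v))"
      by (simp add: power2_norm_eq_inner inner_diff inner_commute algebra_simps)
    also have "(s + t - s0)\<^sup>2 - (s - s0)\<^sup>2 = t * (2 * (s - s0) + t)"
      by (simp add: power2_eq_square algebra_simps)
    finally have "t * r \<le> t * (z \<bullet> v + 2 * (s - s0) + t * (N * (norm v)\<^sup>2 + 1))"
      by (simp add: z_def algebra_simps)
    then have "r \<le> z \<bullet> v + 2 * (s - s0) + t * (N * (norm v)\<^sup>2 + 1)" using t(1) by simp
    then show "r - 2 * (s - s0) \<le> z \<bullet> v + e" using te by linarith
  qed
  ultimately show False using ys(4) by linarith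
qed

section \<open>Symmetry of mixed second differences\<close>

lemma gradient_along_line:
  fixes \<phi> :: "'a::euclidean_space \<Rightarrow> real"
  assumes der: "\<And>x. (\<phi> has_derivative (\<lambda>h. g x \<bullet> h)) (at x)"
  shows "((\<lambda>t. \<phi> (a + t *\<^sub>R b)) has_real_derivative g (a + t *\<^sub>R b) \<bullet> b) (at t)"
proof -
  have "((\<lambda>t. \<phi> (a + t *\<^sub>R b)) has_derivative (\<lambda>h. g (a + t *\<^sub>R b) \<bullet> (h *\<^sub>R b))) (at t)"
    by (rule has_derivative_compose[OF _ der]) (auto intro!: derivative_eq_intros)
  then show ?thesis by (simp add: has_field_derivative_def mult.commute[of _ "_ \<bullet> _"])
qed

text \<open>The second difference of \<open>\<phi>\<close> over the parallelogram spanned by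
  \<open>s *\<^sub>R w\<close> and \<open>t *\<^sub>R d\<close> is read in two ways. Dividing by
  \<open>t\<close> and letting it vanish gives the increment of
  \<open>\<langle>d, g\<rangle>\<close> along \<open>w\<close>; the mean value theorem along
  \<open>w\<close> expresses it through increments of \<open>\<langle>w, g\<rangle>\<close> along
  \<open>d\<close>, which are bounded. Only first derivatives of \<open>\<phi>\<close>
  occur.\<close>

lemma gradient_second_difference_symmetric:
  fixes \<phi> :: "'a::euclidean_space \<Rightarrow> real"
  assumes der: "\<And>x. (\<phi> has_derivative (\<lambda>h. g x \<bullet> h)) (at x)"
    and S: "open S" "convex S"
    and le: "\<And>y t. y \<in> S \<Longrightarrow> t > 0 \<Longrightarrow> y + t *\<^sub>R d \<in> S \<Longrightarrow> w \<bullet> g (y + t *\<^sub>R d) - w \<bullet> g y \<le> t * \<alpha>"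
    and y: "y \<in> S" "y + s *\<^sub>R w \<in> S" and s: "s > 0"
  shows "d \<bullet> g (y + s *\<^sub>R w) - d \<bullet> g y \<le> s * \<alpha>"
proof -
  note dline = gradient_along_line[OF der]
  define D where "D t = \<phi> (y + s *\<^sub>R w + t *\<^sub>R d) - \<phi> (y + t *\<^sub>R d)" for t
  have "(D has_real_derivative (d \<bullet> g (y + s *\<^sub>R w) - d \<bullet> g y)) (at 0)"
    unfolding D_def using DERIV_diff[OF dline[of "y + s *\<^sub>R w" d 0] dline[of y d 0]]
    by (simp add: inner_commute)
  then have lim: "((\<lambda>t. (D t - D 0) / t) \<longlongrightarrow> d \<bullet> g (y + s *\<^sub>R w) - d \<bullet> g y) (at_right 0)"
    unfolding has_field_derivative_iff by (auto intro: tendsto_within_subset)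
  have ev: "eventually (\<lambda>t. b + t *\<^sub>R d \<in> S) (at_right 0)" if "b \<in> S" for b
  proof -
    have "((\<lambda>t::real. b + t *\<^sub>R d) \<longlongrightarrow> b + 0 *\<^sub>R d) (at_right 0)" by (intro tendsto_intros)
    then show ?thesis using S(1) that by (intro topological_tendstoD) auto
  qed
  have "eventually (\<lambda>t. (D t - D 0) / t \<le> s * \<alpha>) (at_right 0)"
    using ev[OF y(1)] ev[OF y(2)] eventually_at_right_less[of 0]
  proof eventually_elim
    case (elim t)
    \<comment> \<open>The mean value theorem in the \<open>w\<close> variable, applied to the
      difference of \<open>\<phi>\<close> along two parallel segments. Convexity of \<open>S\<close>
      then places the intermediate points in \<open>S\<close>.\<close>
    have "\<exists>z. 0 < z \<and> z < s \<and>
      (\<phi> (y + t *\<^sub>R d + s *\<^sub>R w) - \<phi> (y + s *\<^sub>R w)) - (\<phi> (y + t *\<^sub>R d + 0 *\<^sub>R w) - \<phi> (y + 0 *\<^sub>R w))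
       = (s - 0) * (g (y + t *\<^sub>R d + z *\<^sub>R w) \<bullet> w - g (y + z *\<^sub>R w) \<bullet> w)"
      by (rule MVT2[OF s]) (intro DERIV_diff dline)
    then obtain z where z: "0 < z" "z < s" "D t - D 0 = s * (w \<bullet> g (y + z *\<^sub>R w + t *\<^sub>R d) - w \<bullet> g (y + z *\<^sub>R w))"
      by (auto simp: D_def algebra_simps inner_commute)
    have seg: "b + z *\<^sub>R w \<in> S" if "b \<in> S" "b + s *\<^sub>R w \<in> S" for b
    proof -
      have "(1 - z / s) *\<^sub>R b + (z / s) *\<^sub>R (b + s *\<^sub>R w) \<in> S"
        using z that by (intro convexD_alt[OF S(2)]) auto
      then show ?thesis using z by (simp add: algebra_simps)
    qed
    have "y + z *\<^sub>R w \<in> S" "y + z *\<^sub>R w + t *\<^sub>R d \<in> S"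
      using seg[OF y] seg[of "y + t *\<^sub>R d"] elim by (auto simp: algebra_simps)
    then have "D t - D 0 \<le> s * (t * \<alpha>)"
      unfolding z(3) using le elim s by (intro mult_left_mono) auto
    then show ?case using elim by (simp add: field_simps)
  qed
  then show ?thesis by (rule tendsto_upperbound[OF lim]) simp
qed

subsection \<open>Second-order subdifferentials of C11 functions\<close>

lemma C11_has_derivative: "C11 \<phi> g \<Longrightarrow> (\<phi> has_derivative (\<lambda>h. g x \<bullet> h)) (at x)"
  by (simp add: C11_def)

lemma C11_tendsto_gradient:
  assumes "C11 \<phi> g" "(f \<longlongrightarrow> x) F"
  shows "((\<lambda>k. g (f k)) \<longlongrightarrow> g x) F"
  using assms by (auto simp: C11_def intro: continuous_on_tendsto_compose)

lemma C11_lipschitz: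
  assumes "C11 \<phi> g"
  obtains \<delta> L where "\<delta> > 0" "L > 0"
    "\<And>y z. y \<in> ball x \<delta> \<Longrightarrow> z \<in> ball x \<delta> \<Longrightarrow> norm (g y - g z) \<le> L * norm (y - z)"
proof -
  obtain \<delta> L where d: "\<delta> > 0"
    "\<And>y z. y \<in> ball x \<delta> \<Longrightarrow> z \<in> ball x \<delta> \<Longrightarrow> dist (g y) (g z) \<le> L * dist y z"
    using assms unfolding C11_def by meson
  show ?thesis
  proof (rule that[of \<delta> "max L 1"])
    fix y z assume "y \<in> ball x \<delta>" "z \<in> ball x \<delta>"
    then have "norm (g y - g z) \<le> L * norm (y - z)" using d(2) by (simp add: dist_norm)
    also have "\<dots> \<le> max L 1 * norm (y - z)" by (intro mult_right_mono) auto
    finally show "norm (g y - g z) \<le> max L 1 * norm (y - z)" .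
  qed (use d in auto)
qed

lemma C11_reg_normal_cone_graph_iff:
  assumes "C11 \<phi> g"
  shows "(z, - u) \<in> reg_normal_cone (graph (\<lambda>x. {g x})) (y, g y) \<longleftrightarrow> reg_subgrad (\<lambda>x. u \<bullet> g x) y z"
proof -
  obtain \<delta> L where "\<delta> > 0" "L > 0"
    "\<And>w z. w \<in> ball y \<delta> \<Longrightarrow> z \<in> ball y \<delta> \<Longrightarrow> norm (g w - g z) \<le> L * norm (w - z)"
    using C11_lipschitz[OF assms] by metis
  then show ?thesis by (intro reg_normal_cone_graph_iff[where \<delta> = \<delta> and L = L]) auto
qed

text \<open>Every point of the graph is \<open>(y, g y)\<close>, so by continuity of
  \<open>g\<close> only convergence of the base points matters, and graph normals translate into
  regular subgradients with the sign of the second component reversed.\<close>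

lemma hess2_iff:
  assumes C: "C11 \<phi> g"
  shows "z \<in> hess2 g p u \<longleftrightarrow> (\<exists>ys zs us. ys \<longlonglongrightarrow> p \<and> zs \<longlonglongrightarrow> z \<and> us \<longlonglongrightarrow> u
    \<and> (\<forall>k. reg_subgrad (\<lambda>x. us k \<bullet> g x) (ys k) (zs k)))" (is "_ \<longleftrightarrow> ?R")
proof
  let ?G = "graph (\<lambda>x. {g x})"
  assume "z \<in> hess2 g p u"
  then obtain q v where q: "\<And>k. q k \<in> ?G" "q \<longlonglongrightarrow> (p, g p)" "v \<longlonglongrightarrow> (z, - u)"
      "\<And>k. v k \<in> reg_normal_cone ?G (q k)"
    unfolding hess2_def coderiv_def lim_normal_cone_def by auto
  have "reg_subgrad (\<lambda>x. (- snd (v k)) \<bullet> g x) (fst (q k)) (fst (v k))" for k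
  proof -
    have "q k = (fst (q k), g (fst (q k)))" using q(1)[of k] by (auto simp: graph_def)
    then show ?thesis
      using q(4)[of k] C11_reg_normal_cone_graph_iff[OF C, of "fst (v k)" "- snd (v k)" "fst (q k)"] by simp
  qed
  moreover have "(\<lambda>k. fst (q k)) \<longlonglongrightarrow> p" "(\<lambda>k. fst (v k)) \<longlonglongrightarrow> z" "(\<lambda>k. - snd (v k)) \<longlonglongrightarrow> u"
    using tendsto_fst[OF q(2)] tendsto_fst[OF q(3)] tendsto_minus[OF tendsto_snd[OF q(3)]] by auto
  ultimately show ?R by blast
next
  let ?G = "graph (\<lambda>x. {g x})"
  assume ?R
  then obtain ys zs us where h: "ys \<longlonglongrightarrow> p" "zs \<longlonglongrightarrow> z" "us \<longlonglongrightarrow> u"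
    "\<And>k. reg_subgrad (\<lambda>x. us k \<bullet> g x) (ys k) (zs k)" by blast
  have "(\<lambda>k. (ys k, g (ys k))) \<longlonglongrightarrow> (p, g p)" "(\<lambda>k. (zs k, - us k)) \<longlonglongrightarrow> (z, - u)"
    using h C11_tendsto_gradient[OF C h(1)] by (auto intro!: tendsto_intros)
  moreover have "(zs k, - us k) \<in> reg_normal_cone ?G (ys k, g (ys k))" for k
    using h(4) C11_reg_normal_cone_graph_iff[OF C] by simp
  moreover have "(ys k, g (ys k)) \<in> ?G" for k by (simp add: graph_def)
  ultimately show "z \<in> hess2 g p u"
    unfolding hess2_def coderiv_def lim_normal_cone_def mem_Collect_eq
    by (intro exI[of _ "\<lambda>k. (ys k, g (ys k))"] exI[of _ "\<lambda>k. (zs k, - us k)"]) simp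
qed

text \<open>Test the subgradient in its own direction \<open>z\<close> and bound the increment by
  Cauchy-Schwarz and the Lipschitz estimate.\<close>

lemma reg_subgrad_norm_le:
  fixes g :: "'a::euclidean_space \<Rightarrow> 'b::euclidean_space"
  assumes lip: "\<And>y z. y \<in> S \<Longrightarrow> z \<in> S \<Longrightarrow> norm (g y - g z) \<le> L * norm (y - z)"
    and S: "open S" "y \<in> S" and z: "reg_subgrad (\<lambda>x. u \<bullet> g x) y z"
  shows "norm z \<le> L * norm u"
proof -
  have "eventually (\<lambda>s. y + s *\<^sub>R z \<in> S) (at_right 0)"
  proof -
    have "((\<lambda>t::real. y + t *\<^sub>R z) \<longlongrightarrow> y + 0 *\<^sub>R z) (at_right 0)" by (intro tendsto_intros)
    then show ?thesis using S by (intro topological_tendstoD) auto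
  qed
  then obtain \<delta> where d: "\<delta> > 0" "\<And>s. 0 < s \<Longrightarrow> s < \<delta> \<Longrightarrow> y + s *\<^sub>R z \<in> S"
    unfolding eventually_at_right_field by auto
  have "z \<bullet> z \<le> norm u * (L * norm z)"
  proof (rule reg_subgrad_inner_le[OF z d(1)])
    fix s :: real assume s: "0 < s" "s < \<delta>"
    have "u \<bullet> g (y + s *\<^sub>R z) - u \<bullet> g y = u \<bullet> (g (y + s *\<^sub>R z) - g y)" by (simp add: inner_diff_right)
    also have "\<dots> \<le> norm u * norm (g (y + s *\<^sub>R z) - g y)" by (rule norm_cauchy_schwarz)
    also have "\<dots> \<le> norm u * (L * norm (s *\<^sub>R z))"
      using lip[OF d(2)[OF s] S(2)] by (intro mult_left_mono) auto
    also have "\<dots> = s * (norm u * (L * norm z))" using s by simp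
    finally show "u \<bullet> g (y + s *\<^sub>R z) - u \<bullet> g y \<le> s * (norm u * (L * norm z))" .
  qed
  then have "norm z * norm z \<le> norm z * (L * norm u)"
    by (simp add: power2_norm_eq_inner[symmetric] power2_eq_square mult.commute mult.left_commute)
  \<comment> \<open>When \<open>z = 0\<close> the factor \<open>norm z\<close> cannot be cancelled;
    the claim then rests on \<open>L \<ge> 0\<close>, which follows from the Lipschitz bound at two
    distinct points of \<open>S\<close>.\<close>
  moreover have "norm z = 0 \<Longrightarrow> 0 \<le> L * norm u"
  proof (cases "u = 0")
    case False
    obtain e where e: "e > 0" "ball y e \<subseteq> S" using S open_contains_ball by blast
    obtain b :: 'a where b: "norm b = 1" using vector_choose_size[of 1] by auto
    have "y + (e / 2) *\<^sub>R b \<in> S" using e b by (auto simp: dist_norm subset_iff)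
    from order_trans[OF norm_ge_zero lip[OF this S(2)]] have "0 \<le> L * (e / 2)" using b e by simp
    then show ?thesis using e by (simp add: zero_le_mult_iff)
  qed simp
  ultimately show ?thesis
    by (cases "norm z = 0") auto
qed

lemma hess2_norm_le:
  assumes C: "C11 \<phi> g"
    and lip: "\<And>y z. y \<in> S \<Longrightarrow> z \<in> S \<Longrightarrow> norm (g y - g z) \<le> L * norm (y - z)"
    and S: "open S" "p \<in> S" and z: "z \<in> hess2 g p u"
  shows "norm z \<le> L * norm u"
proof -
  obtain ys zs us where h: "ys \<longlonglongrightarrow> p" "zs \<longlonglongrightarrow> z" "us \<longlonglongrightarrow> u"
    "\<And>k. reg_subgrad (\<lambda>x. us k \<bullet> g x) (ys k) (zs k)" using z unfolding hess2_iff[OF C] by blast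
  have ev: "eventually (\<lambda>k. ys k \<in> S) sequentially" using h(1) S by (intro topological_tendstoD)
  show ?thesis
  proof (rule tendsto_le[OF sequentially_bot])
    show "(\<lambda>k. L * norm (us k)) \<longlonglongrightarrow> L * norm u" "(\<lambda>k. norm (zs k)) \<longlonglongrightarrow> norm z"
      using h by (auto intro!: tendsto_intros)
    show "eventually (\<lambda>k. norm (zs k) \<le> L * norm (us k)) sequentially"
      using ev
      by eventually_elim (rule reg_subgrad_norm_le[OF lip S(1) _ h(4)])
  qed
qed

lemma hess2_inner_ge:
  assumes C: "C11 \<phi> g" and S: "open S" "p \<in> S" and z: "z \<in> hess2 g p u"
    and pd: "\<And>y w \<zeta>. y \<in> S \<Longrightarrow> reg_subgrad (\<lambda>x. w \<bullet> g x) y \<zeta> \<Longrightarrow> \<zeta> \<bullet> w \<ge> c * (norm w)\<^sup>2"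
  shows "z \<bullet> u \<ge> c * (norm u)\<^sup>2"
proof -
  obtain ys zs us where h: "ys \<longlonglongrightarrow> p" "zs \<longlonglongrightarrow> z" "us \<longlonglongrightarrow> u"
    "\<And>k. reg_subgrad (\<lambda>x. us k \<bullet> g x) (ys k) (zs k)" using z unfolding hess2_iff[OF C] by blast
  have ev: "eventually (\<lambda>k. ys k \<in> S) sequentially" using h(1) S by (intro topological_tendstoD)
  show ?thesis
  proof (rule tendsto_le[OF sequentially_bot])
    show "(\<lambda>k. zs k \<bullet> us k) \<longlonglongrightarrow> z \<bullet> u" "(\<lambda>k. c * (norm (us k))\<^sup>2) \<longlonglongrightarrow> c * (norm u)\<^sup>2"
      using h by (auto intro!: tendsto_intros)
    show "eventually (\<lambda>k. c * (norm (us k))\<^sup>2 \<le> zs k \<bullet> us k) sequentially"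
      using ev by eventually_elim (rule pd[OF _ h(4)])
  qed
qed

text \<open>The substitute for symmetry of the Hessian: \<open>d\<close> and \<open>w\<close>
  exchange roles. The mean value inequality and the second differences bound increments of
  \<open>\<langle>d, g\<rangle>\<close> along \<open>w\<close> on a whole neighbourhood, and this
  bound passes to the subgradients whose limit is \<open>z\<close>.\<close>

lemma hess2_inner_le_dual:
  assumes C: "C11 \<phi> g" and z: "z \<in> hess2 g p d" and \<rho>: "\<rho> > 0"
    and sub: "\<And>y \<zeta>. y \<in> ball p \<rho> \<Longrightarrow> reg_subgrad (\<lambda>x. w \<bullet> g x) y \<zeta> \<Longrightarrow> \<zeta> \<bullet> d \<le> \<alpha>"
  shows "z \<bullet> w \<le> \<alpha>"
proof -
  obtain \<delta> L where L: "\<delta> > 0" "L > 0"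
    "\<And>y z. y \<in> ball p \<delta> \<Longrightarrow> z \<in> ball p \<delta> \<Longrightarrow> norm (g y - g z) \<le> L * norm (y - z)"
    using C11_lipschitz[OF C] by metis
  define S where "S = ball p (min \<delta> \<rho>)"
  have S: "open S" "convex S" "p \<in> S" "S \<subseteq> ball p \<rho>" "S \<subseteq> ball p \<delta>"
    using L \<rho> by (auto simp: S_def)
  have cont: "continuous_on S (\<lambda>x. w \<bullet> g x)"
    using C unfolding C11_def by (intro continuous_intros) (auto intro: continuous_on_subset)
  have inc: "w \<bullet> g (y + t *\<^sub>R d) - w \<bullet> g y \<le> t * \<alpha>"
    if "y \<in> S" "t > 0" "y + t *\<^sub>R d \<in> S" for y t
    by (rule increment_le_if_reg_subgrad_le[OF cont S(1,2)]) (use that sub S(4) in \<open>auto simp: subset_iff\<close>)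
  have sym: "d \<bullet> g (y + s *\<^sub>R w) - d \<bullet> g y \<le> s * \<alpha>" if "y \<in> S" "y + s *\<^sub>R w \<in> S" "s > 0" for y s
    using gradient_second_difference_symmetric[OF C11_has_derivative[OF C] S(1,2) inc] that by blast
  obtain ys zs us where h: "ys \<longlonglongrightarrow> p" "zs \<longlonglongrightarrow> z" "us \<longlonglongrightarrow> d"
    "\<And>k. reg_subgrad (\<lambda>x. us k \<bullet> g x) (ys k) (zs k)" using z unfolding hess2_iff[OF C] by blast
  have ev: "eventually (\<lambda>k. ys k \<in> S) sequentially" using h(1) S by (intro topological_tendstoD)
  \<comment> \<open>Replacing \<open>us k\<close> by its limit \<open>d\<close> costs at most
    \<open>norm (us k - d) * (L * norm w)\<close>. The limit of this error is kept in the form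
    \<open>norm (d - d)\<close> and vanishes at the end.\<close>
  have "z \<bullet> w \<le> \<alpha> + norm (d - d) * (L * norm w)"
  proof (rule tendsto_le[OF sequentially_bot])
    show "(\<lambda>k. zs k \<bullet> w) \<longlonglongrightarrow> z \<bullet> w"
      "(\<lambda>k. \<alpha> + norm (us k - d) * (L * norm w)) \<longlonglongrightarrow> \<alpha> + norm (d - d) * (L * norm w)"
      by (intro tendsto_intros h)+
    show "eventually (\<lambda>k. zs k \<bullet> w \<le> \<alpha> + norm (us k - d) * (L * norm w)) sequentially"
      using ev
    proof eventually_elim
      case (elim k)
      have "((\<lambda>t::real. ys k + t *\<^sub>R w) \<longlongrightarrow> ys k + 0 *\<^sub>R w) (at_right 0)" by (intro tendsto_intros)
      then have "eventually (\<lambda>s. ys k + s *\<^sub>R w \<in> S) (at_right 0)"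
        using S(1) elim by (intro topological_tendstoD) auto
      then obtain e where e: "e > 0" "\<And>s. 0 < s \<Longrightarrow> s < e \<Longrightarrow> ys k + s *\<^sub>R w \<in> S"
        unfolding eventually_at_right_field by auto
      show ?case
      proof (rule reg_subgrad_inner_le[OF h(4) e(1)])
        fix s :: real assume s: "0 < s" "s < e"
        let ?D = "g (ys k + s *\<^sub>R w) - g (ys k)"
        have "us k \<bullet> ?D = d \<bullet> ?D + (us k - d) \<bullet> ?D" by (simp add: inner_diff_left)
        also have "d \<bullet> ?D \<le> s * \<alpha>"
          using sym[OF elim e(2)[OF s] s(1)] by (simp add: inner_diff_right)
        also have "(us k - d) \<bullet> ?D \<le> norm (us k - d) * norm ?D" by (rule norm_cauchy_schwarz)
        also have "\<dots> \<le> norm (us k - d) * (L * norm (s *\<^sub>R w))"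
          using L(3)[of "ys k + s *\<^sub>R w" "ys k"] e(2)[OF s] elim S(5) by (intro mult_left_mono) (auto simp: subset_iff)
        finally have "us k \<bullet> ?D \<le> s * \<alpha> + norm (us k - d) * (L * norm (s *\<^sub>R w))" by simp
        then show "us k \<bullet> g (ys k + s *\<^sub>R w) - us k \<bullet> g (ys k)
            \<le> s * (\<alpha> + norm (us k - d) * (L * norm w))"
          using s by (simp add: inner_diff_right algebra_simps)
      qed
    qed
  qed
  then show ?thesis by simp
qed

text \<open>The mean value inequality gives upper bounds, so it is applied to
  \<open>\<langle>y - z, g\<rangle>\<close> along the reversed direction
  \<open>z - y\<close>.\<close>

lemma strongly_monotone_if_reg_subgrad_ge:
  assumes C: "C11 \<phi> g" and S: "open S" "convex S" and yz: "y \<in> S" "z \<in> S"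
    and pd: "\<And>y w \<zeta>. y \<in> S \<Longrightarrow> reg_subgrad (\<lambda>x. w \<bullet> g x) y \<zeta> \<Longrightarrow> \<zeta> \<bullet> w \<ge> c * (norm w)\<^sup>2"
  shows "(g y - g z) \<bullet> (y - z) \<ge> c * (norm (y - z))\<^sup>2"
proof -
  have cont: "continuous_on S (\<lambda>x. (y - z) \<bullet> g x)"
    using C unfolding C11_def by (intro continuous_intros) (auto intro: continuous_on_subset)
  have "(y - z) \<bullet> g (y + (z - y)) - (y - z) \<bullet> g y \<le> - (c * (norm (y - z))\<^sup>2)"
  proof (rule increment_le_if_reg_subgrad_le[OF cont S])
    fix p \<zeta> assume "p \<in> S" "reg_subgrad (\<lambda>x. (y - z) \<bullet> g x) p \<zeta>"
    from pd[OF this] show "\<zeta> \<bullet> (z - y) \<le> - (c * (norm (y - z))\<^sup>2)" by (simp add: inner_diff_right)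
  qed (use yz in auto)
  then show ?thesis by (simp add: inner_diff_left inner_diff_right inner_commute)
qed

section \<open>Uniform estimates near a point by compactness\<close>

lemma reg_subgrad_bounded_subsequence:
  fixes g :: "'a::euclidean_space \<Rightarrow> 'a" and y z w :: "nat \<Rightarrow> 'a"
  assumes lip: "\<And>y z. y \<in> ball p \<delta> \<Longrightarrow> z \<in> ball p \<delta> \<Longrightarrow> norm (g y - g z) \<le> L * norm (y - z)"
    and "\<And>n. y n \<in> ball p \<delta>" and "\<And>n. norm (w n) = 1"
    and "\<And>n. reg_subgrad (\<lambda>x. w n \<bullet> g x) (y n) (z n)"
  obtains k zl wl where "strict_mono k" "(\<lambda>n. z (k n)) \<longlonglongrightarrow> zl" "(\<lambda>n. w (k n)) \<longlonglongrightarrow> wl" "norm wl = 1"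
proof -
  have "norm (z n) \<le> L" for n
    using reg_subgrad_norm_le[OF lip open_ball assms(2) assms(4), of n] assms(3) by simp
  then have mem: "(z n, w n) \<in> cball 0 L \<times> sphere 0 1" for n using assms(3) by simp
  have cmp: "compact (cball (0::'a) L \<times> sphere (0::'a) 1)" by (intro compact_Times) auto
  obtain l k where l: "l \<in> cball 0 L \<times> sphere 0 1" "strict_mono k" "((\<lambda>n. (z n, w n)) \<circ> k) \<longlonglongrightarrow> l"
    using cmp[unfolded compact_def, rule_format, of "\<lambda>n. (z n, w n)"] mem by blast
  show ?thesis
    using that[of k "fst l" "snd l"] l tendsto_fst[OF l(3)] tendsto_snd[OF l(3)]
    by (auto simp: o_def mem_Times_iff)
qed

lemma reg_subgrad_normalize:
  assumes "reg_subgrad (\<lambda>x. w \<bullet> g x) y z" "w \<noteq> 0"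
  shows "reg_subgrad (\<lambda>x. (w /\<^sub>R norm w) \<bullet> g x) y (z /\<^sub>R norm w)"
  using reg_subgrad_scale[OF assms(1), of "inverse (norm w)"] assms(2) by simp

text \<open>Otherwise there are counterexamples with constants \<open>1 / (n + 1)\<close> at points
  tending to \<open>p\<close>. Both sides scale quadratically in \<open>w\<close>, so
  \<open>w\<close> may be normalised; a subsequence then converges to a nonzero \<open>wl\<close>
  and some \<open>zl \<in> hess2 g p wl\<close> with
  \<open>\<langle>zl, wl\<rangle> \<le> 0\<close>.\<close>

lemma hess2_posdef_imp_uniform:
  assumes C: "C11 \<phi> g"
    and pd: "\<And>u z. u \<noteq> 0 \<Longrightarrow> z \<in> hess2 g p u \<Longrightarrow> z \<bullet> u > 0"
  obtains c r where "c > 0" "r > 0"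
    "\<And>y w \<zeta>. y \<in> ball p r \<Longrightarrow> reg_subgrad (\<lambda>x. w \<bullet> g x) y \<zeta> \<Longrightarrow> \<zeta> \<bullet> w \<ge> c * (norm w)\<^sup>2"
proof -
  obtain \<delta> L where L: "\<delta> > 0" "L > 0"
    "\<And>y z. y \<in> ball p \<delta> \<Longrightarrow> z \<in> ball p \<delta> \<Longrightarrow> norm (g y - g z) \<le> L * norm (y - z)"
    using C11_lipschitz[OF C] by metis
  define R where "R n = min \<delta> (inverse (real (Suc n)))" for n
  have R: "R n > 0" "R n \<le> \<delta>" "R n \<le> inverse (real (Suc n))" for n using L by (auto simp: R_def)
  have "\<exists>n. \<forall>y w \<zeta>. y \<in> ball p (R n) \<longrightarrow> reg_subgrad (\<lambda>x. w \<bullet> g x) y \<zeta>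
      \<longrightarrow> \<zeta> \<bullet> w \<ge> inverse (real (Suc n)) * (norm w)\<^sup>2"
  proof (rule ccontr)
    assume "\<not> ?thesis"
    then have "\<forall>n. \<exists>y w \<zeta>. y \<in> ball p (R n) \<and> reg_subgrad (\<lambda>x. w \<bullet> g x) y \<zeta>
      \<and> \<zeta> \<bullet> w < inverse (real (Suc n)) * (norm w)\<^sup>2" by (auto simp: not_le)
    then obtain y w \<zeta> where h: "\<And>n. y n \<in> ball p (R n)"
        "\<And>n. reg_subgrad (\<lambda>x. w n \<bullet> g x) (y n) (\<zeta> n)"
        "\<And>n. \<zeta> n \<bullet> w n < inverse (real (Suc n)) * (norm (w n))\<^sup>2" by metis
    have w0: "w n \<noteq> 0" for n using h(3)[of n] by auto
    define w' where "w' n = w n /\<^sub>R norm (w n)" for n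
    define \<zeta>' where "\<zeta>' n = \<zeta> n /\<^sub>R norm (w n)" for n
    have h2: "reg_subgrad (\<lambda>x. w' n \<bullet> g x) (y n) (\<zeta>' n)" for n
      unfolding w'_def \<zeta>'_def by (rule reg_subgrad_normalize[OF h(2) w0])
    have nw: "norm (w' n) = 1" for n using w0 by (simp add: w'_def)
    have h3: "\<zeta>' n \<bullet> w' n \<le> inverse (real (Suc n))" for n
    proof -
      have "\<zeta>' n \<bullet> w' n = (\<zeta> n \<bullet> w n) / (norm (w n))\<^sup>2"
        by (simp add: \<zeta>'_def w'_def power2_eq_square divide_inverse)
      also have "\<dots> \<le> inverse (real (Suc n))" using h(3)[of n] w0[of n] by (simp add: field_simps)
      finally show ?thesis .
    qed
    have yd: "y n \<in> ball p \<delta>" for n using h(1)[of n] R(2)[of n] by auto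
    have yp: "y \<longlonglongrightarrow> p"
    proof (rule metric_tendsto_imp_tendsto[OF LIMSEQ_inverse_real_of_nat])
      show "eventually (\<lambda>n. dist (y n) p \<le> dist (inverse (real (Suc n))) 0) sequentially"
        using h(1) R(3) by (intro always_eventually allI) (auto simp: dist_commute intro: less_imp_le less_le_trans)
    qed
    obtain k zl wl where k: "strict_mono k" "(\<lambda>n. \<zeta>' (k n)) \<longlonglongrightarrow> zl" "(\<lambda>n. w' (k n)) \<longlonglongrightarrow> wl" "norm wl = 1"
      by (rule reg_subgrad_bounded_subsequence[OF L(3) yd nw h2])
    have yk: "(\<lambda>n. y (k n)) \<longlonglongrightarrow> p" using LIMSEQ_subseq_LIMSEQ[OF yp k(1)] by (simp add: o_def)
    have "zl \<in> hess2 g p wl" unfolding hess2_iff[OF C] using yk k(2,3) h2 by blast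
    moreover have "wl \<noteq> 0" using k(4) by auto
    ultimately have "zl \<bullet> wl > 0" using pd by blast
    moreover have "zl \<bullet> wl \<le> 0"
    proof (rule LIMSEQ_le)
      show "(\<lambda>n. \<zeta>' (k n) \<bullet> w' (k n)) \<longlonglongrightarrow> zl \<bullet> wl" using k by (intro tendsto_intros)
      show "(\<lambda>n. inverse (real (Suc (k n)))) \<longlonglongrightarrow> 0"
        using LIMSEQ_subseq_LIMSEQ[OF LIMSEQ_inverse_real_of_nat k(1)] by (simp add: o_def)
    qed (use h3 in auto)
    ultimately show False by simp
  qed
  then obtain n where n: "\<And>y w \<zeta>. y \<in> ball p (R n) \<Longrightarrow> reg_subgrad (\<lambda>x. w \<bullet> g x) y \<zeta>
      \<Longrightarrow> \<zeta> \<bullet> w \<ge> inverse (real (Suc n)) * (norm w)\<^sup>2" by auto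
  show ?thesis
    by (rule that[of "inverse (real (Suc n))" "R n"]) (use R n in auto)
qed

text \<open>Counterexamples are normalised twice: \<open>w\<close> to unit length, and the graph
  displacement from \<open>(p, g p)\<close> by \<open>norm (y - p)\<close>. The limit is a
  directional normal in the limiting direction, where semismoothness* makes the defect zero although
  it stays at least \<open>\<epsilon>\<close> along the sequence.\<close>

lemma semismooth_star_imp_uniform:
  assumes C: "C11 \<phi> g" and ss: "semismooth_star_fun g p" and e: "\<epsilon> > 0"
  obtains r where "r > 0"
    "\<And>y w \<zeta>. y \<in> ball p r \<Longrightarrow> reg_subgrad (\<lambda>x. w \<bullet> g x) y \<zeta>
      \<Longrightarrow> \<bar>\<zeta> \<bullet> (y - p) - w \<bullet> (g y - g p)\<bar> \<le> \<epsilon> * norm (y - p) * norm w"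
proof -
  obtain \<delta> L where L: "\<delta> > 0" "L > 0"
    "\<And>y z. y \<in> ball p \<delta> \<Longrightarrow> z \<in> ball p \<delta> \<Longrightarrow> norm (g y - g z) \<le> L * norm (y - z)"
    using C11_lipschitz[OF C] by metis
  define R where "R n = min \<delta> (inverse (real (Suc n)))" for n
  have R: "R n > 0" "R n \<le> \<delta>" "R n \<le> inverse (real (Suc n))" for n using L by (auto simp: R_def)
  have "\<exists>n. \<forall>y w \<zeta>. y \<in> ball p (R n) \<longrightarrow> reg_subgrad (\<lambda>x. w \<bullet> g x) y \<zeta>
      \<longrightarrow> \<bar>\<zeta> \<bullet> (y - p) - w \<bullet> (g y - g p)\<bar> \<le> \<epsilon> * norm (y - p) * norm w"
  proof (rule ccontr)
    assume "\<not> ?thesis"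
    then have "\<forall>n. \<exists>y w \<zeta>. y \<in> ball p (R n) \<and> reg_subgrad (\<lambda>x. w \<bullet> g x) y \<zeta>
      \<and> \<epsilon> * norm (y - p) * norm w < \<bar>\<zeta> \<bullet> (y - p) - w \<bullet> (g y - g p)\<bar>" by (auto simp: not_le)
    then obtain y w \<zeta> where h: "\<And>n. y n \<in> ball p (R n)"
        "\<And>n. reg_subgrad (\<lambda>x. w n \<bullet> g x) (y n) (\<zeta> n)"
        "\<And>n. \<epsilon> * norm (y n - p) * norm (w n) < \<bar>\<zeta> n \<bullet> (y n - p) - w n \<bullet> (g (y n) - g p)\<bar>" by metis
    have yd: "y n \<in> ball p \<delta>" for n using h(1)[of n] R(2)[of n] by auto
    have y0: "y n \<noteq> p" for n using h(3)[of n] by auto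
    \<comment> \<open>For \<open>w n = 0\<close> the norm bound gives \<open>\<zeta> n = 0\<close>,
      and both sides of the strict inequality would vanish.\<close>
    have w0: "w n \<noteq> 0" for n
    proof
      assume "w n = 0"
      with reg_subgrad_norm_le[OF L(3) open_ball yd h(2), of n] have "\<zeta> n = 0" by simp
      then show False using h(3)[of n] \<open>w n = 0\<close> by simp
    qed
    define w' where "w' n = w n /\<^sub>R norm (w n)" for n
    define \<zeta>' where "\<zeta>' n = \<zeta> n /\<^sub>R norm (w n)" for n
    define t where "t n = norm (y n - p)" for n
    define D where "D n = ((y n - p) /\<^sub>R t n, (g (y n) - g p) /\<^sub>R t n)" for n
    have t: "t n > 0" for n using y0 by (simp add: t_def)
    have h2: "reg_subgrad (\<lambda>x. w' n \<bullet> g x) (y n) (\<zeta>' n)" for n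
      unfolding w'_def \<zeta>'_def by (rule reg_subgrad_normalize[OF h(2) w0])
    have nw: "norm (w' n) = 1" for n using w0 by (simp add: w'_def)
    have h3: "\<epsilon> \<le> \<bar>\<zeta>' n \<bullet> fst (D n) - w' n \<bullet> snd (D n)\<bar>" for n
    proof -
      have "\<zeta>' n \<bullet> fst (D n) - w' n \<bullet> snd (D n)
          = (\<zeta> n \<bullet> (y n - p) - w n \<bullet> (g (y n) - g p)) / (t n * norm (w n))"
        by (simp add: \<zeta>'_def w'_def D_def divide_inverse algebra_simps)
      then have "\<bar>\<zeta>' n \<bullet> fst (D n) - w' n \<bullet> snd (D n)\<bar>
          = \<bar>\<zeta> n \<bullet> (y n - p) - w n \<bullet> (g (y n) - g p)\<bar> / (t n * norm (w n))"
        using t[of n] by (simp add: abs_mult)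
      moreover have "t n * norm (w n) > 0" using t[of n] w0[of n] by simp
      ultimately show ?thesis using h(3)[of n] by (simp add: pos_le_divide_eq t_def mult.assoc)
    qed
    have t0: "t \<longlonglongrightarrow> 0"
    proof (rule tendsto_sandwich[OF _ _ tendsto_const LIMSEQ_inverse_real_of_nat])
      show "eventually (\<lambda>n. t n \<le> inverse (real (Suc n))) sequentially"
        using h(1) R(3) unfolding t_def
        by (intro always_eventually allI) (auto simp: dist_norm norm_minus_commute intro: less_imp_le less_le_trans)
    qed (simp add: t_def)
    have DC: "D n \<in> sphere 0 1 \<times> cball 0 L" for n
    proof -
      have "norm (g (y n) - g p) \<le> L * t n" using L(3)[OF yd, of p n] L(1) by (simp add: t_def)
      then have "norm ((g (y n) - g p) /\<^sub>R t n) \<le> L"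
        using t[of n] by (simp add: divide_inverse[symmetric] mult.commute[of "inverse _"] pos_divide_le_eq)
      moreover have "norm ((y n - p) /\<^sub>R t n) = 1" using t[of n] by (simp add: t_def)
      ultimately show ?thesis unfolding D_def by simp
    qed
    \<comment> \<open>First the scaled graph displacements converge along \<open>k1\<close>, then
      the subgradients and functionals along a further \<open>k2\<close>.\<close>
    have cmp: "compact (sphere (0::'a) 1 \<times> cball (0::'a) L)" by (intro compact_Times) auto
    obtain l k1 where l: "strict_mono k1" "(D \<circ> k1) \<longlonglongrightarrow> l"
      using cmp[unfolded compact_def, rule_format, of D] DC by blast
    obtain k2 zl wl where k2: "strict_mono k2" "(\<lambda>n. \<zeta>' (k1 (k2 n))) \<longlonglongrightarrow> zl"
        "(\<lambda>n. w' (k1 (k2 n))) \<longlonglongrightarrow> wl"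
      by (rule reg_subgrad_bounded_subsequence[where y = "\<lambda>n. y (k1 n)" and w = "\<lambda>n. w' (k1 n)"
            and z = "\<lambda>n. \<zeta>' (k1 n)", OF L(3) yd nw h2])
    define k where "k = k1 \<circ> k2"
    have k: "strict_mono k" "(\<lambda>n. \<zeta>' (k n)) \<longlonglongrightarrow> zl" "(\<lambda>n. w' (k n)) \<longlonglongrightarrow> wl"
      using k2 strict_mono_o[OF l(1) k2(1)] by (auto simp: k_def)
    have Dk: "(\<lambda>n. D (k n)) \<longlonglongrightarrow> l" using LIMSEQ_subseq_LIMSEQ[OF l(2) k2(1)] by (simp add: k_def o_def)
    have tk: "(\<lambda>n. t (k n)) \<longlonglongrightarrow> 0" using LIMSEQ_subseq_LIMSEQ[OF t0 k(1)] by (simp add: o_def)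
    have pt: "(p, g p) + t n *\<^sub>R D n = (y n, g (y n))" for n
      using t[of n] by (simp add: D_def)
    have "(zl, - wl) \<in> dir_normal_cone (graph (\<lambda>x. {g x})) (p, g p) l"
      unfolding dir_normal_cone_def mem_Collect_eq
    proof (intro exI conjI)
      show "\<forall>n. 0 < t (k n)" using t by simp
      show "(\<lambda>n. (\<zeta>' (k n), - w' (k n))) \<longlonglongrightarrow> (zl, - wl)" using k by (intro tendsto_intros)
      show "\<forall>n. (\<zeta>' (k n), - w' (k n)) \<in> reg_normal_cone (graph (\<lambda>x. {g x})) ((p, g p) + t (k n) *\<^sub>R D (k n))"
        unfolding pt using C11_reg_normal_cone_graph_iff[OF C] h2 by simp
    qed (fact tk Dk)+
    then have "zl \<in> dir_coderiv (\<lambda>x. {g x}) p (g p) (fst l) (snd l) wl"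
      by (simp add: dir_coderiv_def)
    then have z0: "zl \<bullet> fst l - wl \<bullet> snd l = 0"
      using ss unfolding semismooth_star_fun_def semismooth_star_def by simp
    have "(\<lambda>n. \<bar>\<zeta>' (k n) \<bullet> fst (D (k n)) - w' (k n) \<bullet> snd (D (k n))\<bar>) \<longlonglongrightarrow> \<bar>zl \<bullet> fst l - wl \<bullet> snd l\<bar>"
      using k Dk by (intro tendsto_intros)
    then have "\<epsilon> \<le> \<bar>zl \<bullet> fst l - wl \<bullet> snd l\<bar>"
      by (rule LIMSEQ_le_const) (use h3 in auto)
    then show False using z0 e by simp
  qed
  then obtain n where "\<And>y w \<zeta>. y \<in> ball p (R n) \<Longrightarrow> reg_subgrad (\<lambda>x. w \<bullet> g x) y \<zeta>
      \<Longrightarrow> \<bar>\<zeta> \<bullet> (y - p) - w \<bullet> (g y - g p)\<bar> \<le> \<epsilon> * norm (y - p) * norm w" by auto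
  then show ?thesis using that[of "R n"] R by auto
qed

section \<open>Error of a full Newton step\<close>

lemma newton_step_error_le:
  assumes C: "C11 \<phi> g" and g0: "g xb = 0"
    and pd: "\<And>y w \<zeta>. y \<in> ball xb r \<Longrightarrow> reg_subgrad (\<lambda>x. w \<bullet> g x) y \<zeta> \<Longrightarrow> \<zeta> \<bullet> w \<ge> c * (norm w)\<^sup>2"
    and ss: "\<And>y w \<zeta>. y \<in> ball xb r \<Longrightarrow> reg_subgrad (\<lambda>x. w \<bullet> g x) y \<zeta>
      \<Longrightarrow> \<bar>\<zeta> \<bullet> (y - xb) - w \<bullet> (g y - g xb)\<bar> \<le> \<epsilon> * norm (y - xb) * norm w"
    and p: "p \<in> ball xb r" and d: "- g p \<in> hess2 g p d"
    and e: "\<epsilon> > 0"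
  shows "c * norm (p + d - xb) \<le> \<epsilon> * norm (p - xb)"
proof -
  define w where "w = p + d - xb"
  obtain \<delta> L where L: "\<delta> > 0" "L > 0"
    "\<And>y z. y \<in> ball p \<delta> \<Longrightarrow> z \<in> ball p \<delta> \<Longrightarrow> norm (g y - g z) \<le> L * norm (y - z)"
    using C11_lipschitz[OF C] by metis
  \<comment> \<open>\<open>G\<close> collects the errors at a point \<open>y\<close> near
    \<open>p\<close>. It is continuous at \<open>p\<close>, where its last term vanishes, and the
    term \<open>w \<bullet> g p\<close> of \<open>G p\<close> cancels the left-hand side of the dual
    estimate for the test vector \<open>- w\<close>.\<close>
  define G where "G y = w \<bullet> g y + \<epsilon> * norm (y - xb) * norm w + L * norm w * norm (y - p)" for y
  have "(G \<longlongrightarrow> G p) (at p)"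
    unfolding G_def by (intro tendsto_intros C11_tendsto_gradient[OF C])
  have "c * (norm w)\<^sup>2 \<le> \<epsilon> * norm (p - xb) * norm w"
  proof (rule field_le_epsilon)
    fix \<eta> :: real assume "\<eta> > 0"
    then have "eventually (\<lambda>y. G y < G p + \<eta>) (at p)"
      using \<open>(G \<longlongrightarrow> G p) (at p)\<close> by (intro order_tendstoD) auto
    then have "eventually (\<lambda>y. G y < G p + \<eta>) (nhds p)"
      unfolding eventually_at_filter by eventually_elim (use \<open>\<eta> > 0\<close> in auto)
    then obtain r1 where r1: "r1 > 0" "\<And>y. dist y p < r1 \<Longrightarrow> G y < G p + \<eta>"
      unfolding eventually_nhds_metric by blast
    obtain r2 where r2: "r2 > 0" "ball p r2 \<subseteq> ball xb r" using p open_ball open_contains_ball by metis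
    define \<rho> where "\<rho> = min \<delta> (min r1 r2)"
    have "(- g p) \<bullet> (- w) \<le> G p + \<eta> - c * (norm w)\<^sup>2"
    proof (rule hess2_inner_le_dual[OF C d])
      show "\<rho> > 0" using L r1 r2 by (simp add: \<rho>_def)
      fix y \<zeta> assume y: "y \<in> ball p \<rho>" and z: "reg_subgrad (\<lambda>x. (- w) \<bullet> g x) y \<zeta>"
      have y': "y \<in> ball xb r" "y \<in> ball p \<delta>" "dist y p < r1"
        using y r2 by (auto simp: \<rho>_def dist_commute)
      have 1: "\<zeta> \<bullet> w \<le> - (c * (norm w)\<^sup>2)" using pd[OF y'(1) z] by simp
      have 2: "- (\<zeta> \<bullet> (y - xb)) \<le> w \<bullet> g y + \<epsilon> * norm (y - xb) * norm w"
        using ss[OF y'(1) z] g0 by (simp add: abs_le_iff)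
      have "\<zeta> \<bullet> (y - p) \<le> norm \<zeta> * norm (y - p)" by (rule norm_cauchy_schwarz)
      also have "\<dots> \<le> L * norm w * norm (y - p)"
        using reg_subgrad_norm_le[OF L(3) open_ball y'(2) z] by (intro mult_right_mono) auto
      finally have 3: "\<zeta> \<bullet> (y - p) \<le> L * norm w * norm (y - p)" .
      \<comment> \<open>The direction splits as \<open>d = w - (y - xb) + (y - p)\<close>. Uniform
        positivity handles the first part, semismoothness* the second and the Lipschitz bound the
        third.\<close>
      have "\<zeta> \<bullet> d = \<zeta> \<bullet> w - \<zeta> \<bullet> (y - xb) + \<zeta> \<bullet> (y - p)"
        by (simp add: w_def algebra_simps)
      also have "\<dots> \<le> G y - c * (norm w)\<^sup>2" using 1 2 3 unfolding G_def by linarith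
      also have "\<dots> \<le> G p + \<eta> - c * (norm w)\<^sup>2" using r1(2)[OF y'(3)] by simp
      finally show "\<zeta> \<bullet> d \<le> G p + \<eta> - c * (norm w)\<^sup>2" .
    qed
    then show "c * (norm w)\<^sup>2 \<le> \<epsilon> * norm (p - xb) * norm w + \<eta>"
      by (simp add: G_def inner_commute)
  qed
  then have "(c * norm w) * norm w \<le> (\<epsilon> * norm (p - xb)) * norm w" by (simp add: power2_eq_square mult.assoc)
  then show ?thesis
    using e by (cases "w = 0") (auto simp: w_def[symmetric])
qed

subsection \<open>Growth estimates and the damped Newton iteration\<close>

text \<open>The mean value theorem after subtracting the parabola \<open>q / 2 * t\<^sup>2\<close>.
  The free \<open>q\<close> is later 0 for the descent estimate,
  \<open>c * (norm (y - xb))\<^sup>2\<close> for quadratic growth, and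
  \<open>g y \<bullet> h\<close> under directional differentiability.\<close>

lemma C11_mvt_quadratic:
  assumes C: "C11 \<phi> g"
  obtains \<theta> where "0 < \<theta>" "\<theta> < 1" "\<phi> (p + h) - \<phi> p - q / 2 = g (p + \<theta> *\<^sub>R h) \<bullet> h - \<theta> * q"
proof -
  let ?F = "\<lambda>t. \<phi> (p + t *\<^sub>R h) - q / 2 * t\<^sup>2"
  have "\<exists>z. 0 < z \<and> z < (1::real) \<and> ?F 1 - ?F 0 = (1 - 0) * (g (p + z *\<^sub>R h) \<bullet> h - z * q)"
  proof (rule MVT2)
    show "(?F has_real_derivative g (p + t *\<^sub>R h) \<bullet> h - t * q) (at t)" for t
      by (rule derivative_eq_intros gradient_along_line[OF C11_has_derivative[OF C]] refl)+ simp
  qed simp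
  then show ?thesis using that by auto
qed

lemma C11_descent:
  assumes C: "C11 \<phi> g" and S: "convex S" "y \<in> S" "y + h \<in> S"
    and lip: "\<And>y z. y \<in> S \<Longrightarrow> z \<in> S \<Longrightarrow> norm (g y - g z) \<le> L * norm (y - z)" and "L > 0"
  shows "\<phi> (y + h) \<le> \<phi> y + g y \<bullet> h + L * (norm h)\<^sup>2"
proof -
  obtain \<theta> where t: "0 < \<theta>" "\<theta> < 1" "\<phi> (y + h) - \<phi> y - 0 / 2 = g (y + \<theta> *\<^sub>R h) \<bullet> h - \<theta> * 0"
    using C11_mvt_quadratic[OF C] by metis
  have "y + \<theta> *\<^sub>R h \<in> S"
    using convexD_alt[OF S, of \<theta>] t by (simp add: algebra_simps)
  then have "norm (g (y + \<theta> *\<^sub>R h) - g y) \<le> L * (\<theta> * norm h)" using lip[of "y + \<theta> *\<^sub>R h" y] S t by simp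
  also have "\<dots> \<le> L * (1 * norm h)"
    using t \<open>L > 0\<close> by (intro mult_left_mono mult_right_mono) auto
  finally have b: "norm (g (y + \<theta> *\<^sub>R h) - g y) \<le> L * norm h" by simp
  have "(g (y + \<theta> *\<^sub>R h) - g y) \<bullet> h \<le> norm (g (y + \<theta> *\<^sub>R h) - g y) * norm h" by (rule norm_cauchy_schwarz)
  also have "\<dots> \<le> L * norm h * norm h" using b by (intro mult_right_mono) auto
  finally show ?thesis using t(3) by (simp add: inner_diff_left power2_eq_square)
qed

text \<open>
  The local conjugate \<open>h t = max (t \<langle>v, z\<rangle> - \<phi> z)\<close> along a ray has slope \<open>\<langle>v, M t\<rangle>\<close>, and \<open>M\<close> is
  Lipschitz; a Riemann sum bounds \<open>h 1\<close> from above, and the Fenchel inequality with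
  \<open>v = (y - xb) / \<kappa>\<close> bounds \<open>\<phi> y\<close> from below.
\<close>

lemma tilt_modulus_quadratic_growth:
  assumes tilt: "tilt_modulus \<phi> xb \<kappa>" and k: "\<kappa> > 0"
  obtains r where "r > 0" "\<And>y. y \<in> ball xb r \<Longrightarrow> \<phi> y \<ge> \<phi> xb + (norm (y - xb))\<^sup>2 / (2 * \<kappa>)"
proof -
  obtain \<gamma> \<epsilon> m where g: "\<gamma> > 0" "\<epsilon> > 0" "tilt_argmin \<phi> xb \<gamma> 0 = {xb}"
      "\<And>v. v \<in> ball 0 \<epsilon> \<Longrightarrow> tilt_argmin \<phi> xb \<gamma> v = {m v}"
      "\<And>v w. v \<in> ball 0 \<epsilon> \<Longrightarrow> w \<in> ball 0 \<epsilon> \<Longrightarrow> dist (m v) (m w) \<le> \<kappa> * dist v w"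
    using tilt unfolding tilt_modulus_def by metis
  have m0: "m 0 = xb" using g(2-3) g(4)[of 0] by simp
  show ?thesis
  proof (rule that[of "min \<gamma> (\<kappa> * \<epsilon>)"])
    show "min \<gamma> (\<kappa> * \<epsilon>) > 0" using g k by simp
    fix y assume y: "y \<in> ball xb (min \<gamma> (\<kappa> * \<epsilon>))"
    \<comment> \<open>This \<open>v\<close> maximises \<open>\<langle>v, y - xb\<rangle> - \<kappa>
      * (norm v)\<^sup>2 / 2\<close>; the radius \<open>\<kappa> * \<epsilon>\<close> keeps it where
      \<open>m\<close> is defined as the minimiser.\<close>
    define v where "v = (y - xb) /\<^sub>R \<kappa>"
    have "norm (y - xb) < \<kappa> * \<epsilon>" using y by (simp add: dist_norm norm_minus_commute)
    moreover have nveq: "norm v = norm (y - xb) / \<kappa>" using k by (simp add: v_def divide_inverse mult.commute)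
    ultimately have nv: "norm v < \<epsilon>" using k by (simp add: pos_divide_less_eq mult.commute)
    define M where "M t = m (t *\<^sub>R v)" for t
    have tv: "t *\<^sub>R v \<in> ball 0 \<epsilon>" if "0 \<le> t" "t \<le> 1" for t
      using mult_right_mono[OF that(2) norm_ge_zero[of v]] nv that by simp
    have M: "M t \<in> cball xb \<gamma>" "\<And>z. z \<in> cball xb \<gamma> \<Longrightarrow> \<phi> (M t) - t * (v \<bullet> M t) \<le> \<phi> z - t * (v \<bullet> z)"
      if "0 \<le> t" "t \<le> 1" for t
    proof -
      have "M t \<in> tilt_argmin \<phi> xb \<gamma> (t *\<^sub>R v)" using g(4)[OF tv[OF that]] by (simp add: M_def)
      then show "M t \<in> cball xb \<gamma>" "\<And>z. z \<in> cball xb \<gamma> \<Longrightarrow> \<phi> (M t) - t * (v \<bullet> M t) \<le> \<phi> z - t * (v \<bullet> z)"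
        by (auto simp: tilt_argmin_def)
    qed
    define h where "h t = t * (v \<bullet> M t) - \<phi> (M t)" for t
    \<comment> \<open>Optimality of \<open>M s\<close>, tested with the competitor
      \<open>M t\<close>.\<close>
    have h1: "h t - h s \<le> (t - s) * (v \<bullet> M t)" if "0 \<le> s" "s \<le> 1" "0 \<le> t" "t \<le> 1" for s t
      using M(2)[OF that(1,2) M(1)[OF that(3,4)]] by (simp add: h_def algebra_simps)
    have h2: "v \<bullet> M t \<le> v \<bullet> xb + \<kappa> * (norm v)\<^sup>2 * t" if "0 \<le> t" "t \<le> 1" for t
    proof -
      have "v \<bullet> (M t - xb) \<le> norm v * norm (M t - xb)" by (rule norm_cauchy_schwarz)
      also have "\<dots> \<le> norm v * (\<kappa> * (t * norm v))"
        using g(5)[OF tv[OF that] tv[of 0]] m0 that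
        by (intro mult_left_mono) (auto simp: M_def dist_norm)
      finally show ?thesis by (simp add: inner_diff_right power2_eq_square algebra_simps)
    qed
    \<comment> \<open>Riemann sum with nodes at the right end points: adding the first
      \<open>i\<close> slopes produces \<open>i * (i + 1) / 2\<close>, which for
      \<open>i = N\<close> tends to one half after division by \<open>N\<^sup>2\<close>.\<close>
    have step: "h (real i / N) - h 0 \<le> real i / N * (v \<bullet> xb) + \<kappa> * (norm v)\<^sup>2 * (real i * (real i + 1) / (2 * N\<^sup>2))"
      if "real i \<le> N" "N > 0" for i N
      using that
    proof (induction i)
      case (Suc i)
      define A where "A = v \<bullet> xb"
      define B where "B = \<kappa> * (norm v)\<^sup>2"
      have "h (real (Suc i) / N) - h (real i / N)
          \<le> (real (Suc i) / N - real i / N) * (v \<bullet> M (real (Suc i) / N))"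
        using Suc.prems by (intro h1) auto
      also have "real (Suc i) / N - real i / N = 1 / N" by (simp add: diff_divide_distrib[symmetric])
      also have "1 / N * (v \<bullet> M (real (Suc i) / N)) \<le> 1 / N * (A + B * (real (Suc i) / N))"
        unfolding A_def B_def using Suc.prems by (intro mult_left_mono h2) auto
      also have "\<dots> = 1 / N * A + B * ((real i + 1) / N\<^sup>2)"
        by (simp add: algebra_simps power2_eq_square add_divide_distrib)
      finally have 1: "h (real (Suc i) / N) - h (real i / N) \<le> 1 / N * A + B * ((real i + 1) / N\<^sup>2)" .
      have 2: "h (real i / N) - h 0 \<le> real i / N * A + B * (real i * (real i + 1) / (2 * N\<^sup>2))"
        unfolding A_def B_def using Suc by simp
      have "real (Suc i) / N * A + B * (real (Suc i) * (real (Suc i) + 1) / (2 * N\<^sup>2))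
        = (real i / N * A + B * (real i * (real i + 1) / (2 * N\<^sup>2))) + (1 / N * A + B * ((real i + 1) / N\<^sup>2))"
        using Suc.prems(2) by (simp add: field_simps power2_eq_square)
      then show ?case using 1 2 unfolding A_def B_def by linarith
    qed simp
    have lim: "(\<lambda>n. v \<bullet> xb + \<kappa> * (norm v)\<^sup>2 / 2 * (1 + inverse (real (Suc n)))) \<longlonglongrightarrow> v \<bullet> xb + \<kappa> * (norm v)\<^sup>2 / 2 * (1 + 0)"
      by (intro tendsto_intros LIMSEQ_inverse_real_of_nat)
    have "h 1 - h 0 \<le> v \<bullet> xb + \<kappa> * (norm v)\<^sup>2 / 2 * (1 + inverse (real (Suc n)))" for n
    proof -
      have "R * (R + 1) / (2 * R\<^sup>2) = (1 + inverse R) / 2" if "R > 0" for R :: real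
        using that by (simp add: power2_eq_square field_simps)
      then have "real (Suc n) * (real (Suc n) + 1) / (2 * (real (Suc n))\<^sup>2) = (1 + inverse (real (Suc n))) / 2"
        by (metis of_nat_0_less_iff zero_less_Suc)
      moreover have "real (Suc n) / real (Suc n) = 1" by simp
      ultimately have "h 1 - h 0 \<le> 1 * (v \<bullet> xb) + \<kappa> * (norm v)\<^sup>2 * ((1 + inverse (real (Suc n))) / 2)"
        using step[of "Suc n" "real (Suc n)"] by (metis of_nat_0_less_iff order_refl zero_less_Suc)
      then show ?thesis by simp
    qed
    then have "h 1 - h 0 \<le> v \<bullet> xb + \<kappa> * (norm v)\<^sup>2 / 2 * (1 + 0)"
      by (intro LIMSEQ_le_const[OF lim]) auto
    moreover have "h 0 = - \<phi> xb" by (simp add: h_def M_def m0)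
    moreover have "- h 1 \<le> \<phi> y - v \<bullet> y"
      using M(2)[of 1 y] y by (simp add: h_def)
    ultimately have "\<phi> y \<ge> \<phi> xb + v \<bullet> (y - xb) - \<kappa> * (norm v)\<^sup>2 / 2"
      by (simp add: inner_diff_right)
    moreover have "v \<bullet> (y - xb) = (norm (y - xb))\<^sup>2 / \<kappa>"
      by (simp add: v_def power2_norm_eq_inner divide_inverse mult.commute)
    moreover have "\<kappa> * (norm v)\<^sup>2 / 2 = (norm (y - xb))\<^sup>2 / (2 * \<kappa>)"
      using k by (simp add: nveq field_simps power2_eq_square)
    moreover have "(norm (y - xb))\<^sup>2 / \<kappa> = (norm (y - xb))\<^sup>2 / (2 * \<kappa>) + (norm (y - xb))\<^sup>2 / (2 * \<kappa>)"
      using k by (simp add: field_simps)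
    ultimately show "\<phi> y \<ge> \<phi> xb + (norm (y - xb))\<^sup>2 / (2 * \<kappa>)" by linarith
  qed
qed

text \<open>Both \<open>g (xb + s *\<^sub>R h)\<close> and \<open>s *\<^sub>R g (xb + h)\<close> are
  close to \<open>s\<close> times the directional derivative along \<open>h\<close>, which is
  positively homogeneous. Compactness of the unit sphere and the Lipschitz bound make this uniform
  in the direction.\<close>

lemma dir_differentiable_imp_uniform:
  assumes C: "C11 \<phi> g" and dd: "dir_differentiable g xb" and g0: "g xb = 0" and e: "e > 0"
  obtains r where "r > 0"
    "\<And>h s. norm h < r \<Longrightarrow> 0 < s \<Longrightarrow> s < 1 \<Longrightarrow> norm (g (xb + s *\<^sub>R h) - s *\<^sub>R g (xb + h)) \<le> e * norm h"
proof -
  obtain \<delta> L where L: "\<delta> > 0" "L > 0"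
    "\<And>y z. y \<in> ball xb \<delta> \<Longrightarrow> z \<in> ball xb \<delta> \<Longrightarrow> norm (g y - g z) \<le> L * norm (y - z)"
    using C11_lipschitz[OF C, where x = xb] by metis
  have "\<exists>n. \<forall>h s. norm h < inverse (real (Suc n)) \<longrightarrow> 0 < s \<longrightarrow> s < 1
    \<longrightarrow> norm (g (xb + s *\<^sub>R h) - s *\<^sub>R g (xb + h)) \<le> e * norm h"
  proof (rule ccontr)
    assume "\<not> ?thesis"
    then have "\<forall>n. \<exists>h s. norm h < inverse (real (Suc n)) \<and> 0 < s \<and> s < 1
      \<and> e * norm h < norm (g (xb + s *\<^sub>R h) - s *\<^sub>R g (xb + h))" by (auto simp: not_le)
    then obtain h s where h: "\<And>n. norm (h n) < inverse (real (Suc n))" "\<And>n. 0 < s n" "\<And>n. s n < 1"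
      "\<And>n. e * norm (h n) < norm (g (xb + s n *\<^sub>R h n) - s n *\<^sub>R g (xb + h n))" by metis
    have h0: "h n \<noteq> 0" for n using h(4)[of n] g0 by auto
    define u where "u n = h n /\<^sub>R norm (h n)" for n
    have u: "norm (u n) = 1" "h n = norm (h n) *\<^sub>R u n" for n using h0 by (auto simp: u_def)
    have "u n \<in> sphere 0 1" for n using u by simp
    then obtain ul k where k: "ul \<in> sphere 0 1" "strict_mono k" "(u \<circ> k) \<longlonglongrightarrow> ul"
      using compact_sphere[of "0::'a" 1, unfolded compact_def, rule_format, of u] by blast
    have t0: "(\<lambda>n. norm (h n)) \<longlonglongrightarrow> 0"
      by (rule tendsto_sandwich[OF _ _ tendsto_const LIMSEQ_inverse_real_of_nat])
         (use h(1) in \<open>auto intro!: always_eventually less_imp_le simp del: of_nat_Suc\<close>)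
    have tk: "(\<lambda>n. norm (h (k n))) \<longlonglongrightarrow> 0" using LIMSEQ_subseq_LIMSEQ[OF t0 k(2)] by (simp add: o_def)
    have uk: "(\<lambda>n. norm (u (k n) - ul)) \<longlonglongrightarrow> norm (ul - ul)"
      using k(3) unfolding o_def by (intro tendsto_intros)
    obtain G where G: "((\<lambda>t. (g (xb + t *\<^sub>R ul) - g xb) /\<^sub>R t) \<longlongrightarrow> G) (at_right 0)"
      using dd unfolding dir_differentiable_def by blast
    have "eventually (\<lambda>t. dist ((g (xb + t *\<^sub>R ul) - g xb) /\<^sub>R t) G < e / 4) (at_right 0)"
      using G e by (intro tendstoD) auto
    then obtain \<tau> where \<tau>: "\<tau> > 0" "\<And>t. 0 < t \<Longrightarrow> t < \<tau> \<Longrightarrow> dist ((g (xb + t *\<^sub>R ul) - g xb) /\<^sub>R t) G < e / 4"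
      unfolding eventually_at_right_field by auto
    have "eventually (\<lambda>n. norm (h (k n)) < min \<tau> \<delta>) sequentially"
      using tk \<tau>(1) L(1) by (intro order_tendstoD) auto
    moreover have "eventually (\<lambda>n. norm (u (k n) - ul) < e / (4 * L)) sequentially"
      using uk e L(2) by (intro order_tendstoD) auto
    ultimately have "eventually (\<lambda>n. norm (h (k n)) < min \<tau> \<delta> \<and> norm (u (k n) - ul) < e / (4 * L)) sequentially"
      by eventually_elim auto
    then obtain n where n: "norm (h (k n)) < min \<tau> \<delta>" "norm (u (k n) - ul) < e / (4 * L)"
      unfolding eventually_sequentially by auto
    define T where "T = norm (h (k n))"
    define v where "v = u (k n)"
    have T: "0 < T" "T < \<tau>" "T < \<delta>" using n h0 by (auto simp: T_def)
    have v: "norm v = 1" "norm ul = 1" "L * norm (v - ul) \<le> e / 4" "h (k n) = T *\<^sub>R v"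
      using u k(1) n(2) L(2) by (auto simp: v_def T_def field_simps)
    \<comment> \<open>One quarter of \<open>e\<close> pays for replacing \<open>v\<close> by the
      limit direction \<open>ul\<close>, another for the difference quotient along
      \<open>ul\<close>. The estimate is used at the radii \<open>S * T\<close> and
      \<open>T\<close>, giving \<open>e * (S * T)\<close> in total.\<close>
    have est: "norm (g (xb + t *\<^sub>R v) - t *\<^sub>R G) \<le> e / 2 * t" if "0 < t" "t \<le> T" for t
    proof -
      have "xb + t *\<^sub>R v \<in> ball xb \<delta>" "xb + t *\<^sub>R ul \<in> ball xb \<delta>" using that T v by (auto simp: dist_norm)
      from L(3)[OF this] have "norm (g (xb + t *\<^sub>R v) - g (xb + t *\<^sub>R ul)) \<le> L * norm (t *\<^sub>R (v - ul))"
        by (simp add: algebra_simps)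
      also have "\<dots> = L * norm (v - ul) * t" using that by simp
      also have "\<dots> \<le> e / 4 * t" using v(3) that by (intro mult_right_mono) auto
      finally have 1: "norm (g (xb + t *\<^sub>R v) - g (xb + t *\<^sub>R ul)) \<le> e / 4 * t" .
      have "g (xb + t *\<^sub>R ul) - t *\<^sub>R G = t *\<^sub>R ((g (xb + t *\<^sub>R ul) - g xb) /\<^sub>R t - G)"
        using that g0 by (simp add: algebra_simps)
      then have "norm (g (xb + t *\<^sub>R ul) - t *\<^sub>R G) = t * dist ((g (xb + t *\<^sub>R ul) - g xb) /\<^sub>R t) G"
        using that by (simp add: dist_norm)
      also have "\<dots> \<le> t * (e / 4)" using \<tau>(2)[of t] that T by (intro mult_left_mono) auto
      finally have 2: "norm (g (xb + t *\<^sub>R ul) - t *\<^sub>R G) \<le> t * (e / 4)" .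
      have "norm (g (xb + t *\<^sub>R v) - t *\<^sub>R G)
          \<le> norm (g (xb + t *\<^sub>R v) - g (xb + t *\<^sub>R ul)) + norm (g (xb + t *\<^sub>R ul) - t *\<^sub>R G)"
        using norm_triangle_ineq[of "g (xb + t *\<^sub>R v) - g (xb + t *\<^sub>R ul)" "g (xb + t *\<^sub>R ul) - t *\<^sub>R G"] by simp
      with 1 2 show ?thesis by (simp add: algebra_simps)
    qed
    define S where "S = s (k n)"
    have S: "0 < S" "S < 1" using h by (auto simp: S_def)
    have ST: "S * T \<le> T" using S T by simp
    have "norm (g (xb + S *\<^sub>R h (k n)) - S *\<^sub>R g (xb + h (k n)))
        = norm ((g (xb + (S * T) *\<^sub>R v) - (S * T) *\<^sub>R G) - S *\<^sub>R (g (xb + T *\<^sub>R v) - T *\<^sub>R G))"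
      by (simp add: v(4) algebra_simps)
    also have "\<dots> \<le> norm (g (xb + (S * T) *\<^sub>R v) - (S * T) *\<^sub>R G) + norm (S *\<^sub>R (g (xb + T *\<^sub>R v) - T *\<^sub>R G))"
      by (rule norm_triangle_ineq4)
    also have "\<dots> \<le> e / 2 * (S * T) + S * (e / 2 * T)"
      using est[of "S * T"] est[of T] S T ST by (intro add_mono) (auto intro!: mult_left_mono)
    also have "\<dots> = e * (S * T)" by (simp add: algebra_simps)
    also have "\<dots> \<le> e * T" using ST e by simp
    finally show False using h(4)[of "k n"] by (simp add: S_def T_def)
  qed
  then obtain n where "\<And>h s. norm h < inverse (real (Suc n)) \<Longrightarrow> 0 < s \<Longrightarrow> s < 1
    \<Longrightarrow> norm (g (xb + s *\<^sub>R h) - s *\<^sub>R g (xb + h)) \<le> e * norm h" by auto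
  then show ?thesis by (intro that[of "inverse (real (Suc n))"]) auto
qed

section \<open>Stationarity of the limit and descent of the iteration\<close>

text \<open>A rejected trial step cannot be too short, so the step sizes stay above some
  \<open>\<tau> > 0\<close> eventually. Since consecutive iterates approach each other,
  \<open>d k\<close> tends to 0, and \<open>g (x k)\<close> is bounded by a multiple of it.\<close>

lemma damped_newton_limit_stationary:
  assumes C: "C11 \<phi> g" and conv: "x \<longlonglongrightarrow> xb" and sigma: "\<sigma> < 1" and beta: "0 < \<beta>" "\<beta> < 1"
    and c: "c > 0" "r > 0"
    and pd: "\<And>y w \<zeta>. y \<in> ball xb r \<Longrightarrow> reg_subgrad (\<lambda>x. w \<bullet> g x) y \<zeta> \<Longrightarrow> \<zeta> \<bullet> w \<ge> c * (norm w)\<^sup>2"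
    and d: "\<And>k. - g (x k) \<in> hess2 g (x k) (d k)"
    and first: "\<And>k i. i < j k \<Longrightarrow> \<not> armijo \<phi> g \<sigma> \<beta> (x k) (d k) i"
    and step: "\<And>k. x (Suc k) = x k + (\<beta> ^ j k) *\<^sub>R d k"
  shows "g xb = 0"
proof -
  obtain \<delta> L where L: "\<delta> > 0" "L > 0"
    "\<And>y z. y \<in> ball xb \<delta> \<Longrightarrow> z \<in> ball xb \<delta> \<Longrightarrow> norm (g y - g z) \<le> L * norm (y - z)"
    using C11_lipschitz[OF C, where x = xb] by metis
  define S where "S = ball xb (min \<delta> r)"
  have S: "open S" "convex S" "xb \<in> S" "S \<subseteq> ball xb \<delta>" "S \<subseteq> ball xb r" using L(1) c(2) by (auto simp: S_def)
  have lipS: "norm (g y - g z) \<le> L * norm (y - z)" if "y \<in> S" "z \<in> S" for y z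
    using L(3) that S(4) by blast
  have pdS: "\<zeta> \<bullet> w \<ge> c * (norm w)\<^sup>2" if "y \<in> S" "reg_subgrad (\<lambda>x. w \<bullet> g x) y \<zeta>" for y w \<zeta>
    using pd that S(5) by blast
  have diff: "(\<lambda>k. x (Suc k) - x k) \<longlonglongrightarrow> xb - xb" by (intro tendsto_intros LIMSEQ_Suc conv)
  \<comment> \<open>The last rejected trial point is one backtracking factor further out. It also
    tends to \<open>xb\<close>, hence enters the region of the local estimates without any prior
    bound on \<open>d k\<close>.\<close>
  have trial: "(\<lambda>k. x k + (1 / \<beta>) *\<^sub>R (x (Suc k) - x k)) \<longlonglongrightarrow> xb + (1 / \<beta>) *\<^sub>R (xb - xb)"
    by (intro tendsto_intros diff conv)
  have ev: "eventually (\<lambda>k. x k \<in> S) sequentially" using conv S by (intro topological_tendstoD)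
  have ev2: "eventually (\<lambda>k. x k + (1 / \<beta>) *\<^sub>R (x (Suc k) - x k) \<in> S) sequentially"
    using trial S(1,3) by (intro topological_tendstoD) auto
  \<comment> \<open>The two entries correspond to an accepted full step and to
    \<open>\<beta>\<close> times a rejected step, the latter having size at least
    \<open>(1 - \<sigma>) * c / L\<close> by the descent estimate.\<close>
  define \<tau> where "\<tau> = min 1 (\<beta> * ((1 - \<sigma>) * c / L))"
  have \<tau>: "\<tau> > 0" using sigma beta c L by (simp add: \<tau>_def)
  have lower: "eventually (\<lambda>k. \<tau> * norm (d k) \<le> norm (x (Suc k) - x k)) sequentially"
    using ev ev2
  proof eventually_elim
    case (elim k)
    have "\<tau> * norm (d k) \<le> \<beta> ^ j k * norm (d k)"
    proof (cases "j k = 0 \<or> d k = 0")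
      case True
      moreover have "\<tau> * norm (d k) \<le> 1 * norm (d k)" by (intro mult_right_mono) (auto simp: \<tau>_def)
      ultimately show ?thesis by auto
    next
      case False
      define t where "t = \<beta> ^ (j k - 1)"
      have t: "t > 0" "\<beta> ^ j k = \<beta> * t" using beta False by (cases "j k"; simp add: t_def)+
      have dk: "norm (d k) > 0" using False by simp
      have "x k + t *\<^sub>R d k \<in> S" using elim(2) step[of k] t beta by simp
      then have "\<phi> (x k + t *\<^sub>R d k) \<le> \<phi> (x k) + g (x k) \<bullet> (t *\<^sub>R d k) + L * (norm (t *\<^sub>R d k))\<^sup>2"
        by (intro C11_descent[OF C S(2) elim(1) _ lipS L(2)])
      moreover have "\<phi> (x k + t *\<^sub>R d k) > \<phi> (x k) + \<sigma> * t * (g (x k) \<bullet> d k)"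
        using first[of "j k - 1" k] False by (simp add: armijo_def t_def)
      ultimately have "\<sigma> * t * (g (x k) \<bullet> d k) < t * (g (x k) \<bullet> d k) + L * (t * norm (d k))\<^sup>2"
        using t(1) by simp
      then have "t * ((1 - \<sigma>) * (- g (x k) \<bullet> d k)) < t * (t * L * (norm (d k))\<^sup>2)"
        by (simp add: algebra_simps power2_eq_square)
      then have 1: "(1 - \<sigma>) * (- g (x k) \<bullet> d k) < t * L * (norm (d k))\<^sup>2"
        using t(1) by (simp only: mult_less_cancel_left_pos)
      have "c * (norm (d k))\<^sup>2 \<le> - g (x k) \<bullet> d k" by (rule hess2_inner_ge[OF C S(1) elim(1) d pdS])
      then have "(1 - \<sigma>) * (c * (norm (d k))\<^sup>2) \<le> (1 - \<sigma>) * (- g (x k) \<bullet> d k)"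
        using sigma by (intro mult_left_mono) auto
      with 1 have "((1 - \<sigma>) * c) * (norm (d k))\<^sup>2 < (t * L) * (norm (d k))\<^sup>2" by (simp add: mult.assoc)
      then have "(1 - \<sigma>) * c < t * L" using dk by simp
      then have "(1 - \<sigma>) * c / L \<le> t" using L(2) by (simp add: pos_divide_le_eq)
      then have "\<beta> * ((1 - \<sigma>) * c / L) \<le> \<beta> ^ j k" unfolding t(2) using beta by (intro mult_left_mono) auto
      then show ?thesis by (intro mult_right_mono) (auto simp: \<tau>_def)
    qed
    also have "\<dots> = norm (x (Suc k) - x k)" using step[of k] beta by simp
    finally show ?case .
  qed
  have ndiff: "(\<lambda>k. norm (x (Suc k) - x k)) \<longlonglongrightarrow> 0" using tendsto_norm[OF diff] by simp
  have "(\<lambda>k. \<tau> * norm (d k)) \<longlonglongrightarrow> 0"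
    by (rule tendsto_sandwich[OF _ lower tendsto_const ndiff]) (use \<tau> in simp)
  then have "(\<lambda>k. L / \<tau> * (\<tau> * norm (d k))) \<longlonglongrightarrow> L / \<tau> * 0" by (intro tendsto_intros)
  then have Ld: "(\<lambda>k. L * norm (d k)) \<longlonglongrightarrow> 0" using \<tau> by simp
  have "eventually (\<lambda>k. norm (g (x k)) \<le> L * norm (d k)) sequentially"
    using ev by eventually_elim (use hess2_norm_le[OF C lipS S(1) _ d] in auto)
  from tendsto_sandwich[OF _ this tendsto_const Ld]
  have "(\<lambda>k. norm (g (x k))) \<longlonglongrightarrow> 0" by simp
  moreover have "(\<lambda>k. norm (g (x k))) \<longlonglongrightarrow> norm (g xb)"
    by (intro tendsto_norm C11_tendsto_gradient[OF C conv])
  ultimately show ?thesis using LIMSEQ_unique by fastforce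
qed

lemma hess2_newton_direction_descent:
  assumes C: "C11 \<phi> g" and pd: "\<And>u z. u \<noteq> 0 \<Longrightarrow> z \<in> hess2 g y u \<Longrightarrow> z \<bullet> u > 0"
    and d: "- g y \<in> hess2 g y d" and "g y \<noteq> 0"
  shows "g y \<bullet> d < 0"
proof -
  obtain \<delta> L where L: "\<delta> > 0" "L > 0"
    "\<And>z w. z \<in> ball y \<delta> \<Longrightarrow> w \<in> ball y \<delta> \<Longrightarrow> norm (g z - g w) \<le> L * norm (z - w)"
    using C11_lipschitz[OF C, where x = y] by metis
  have "norm (- g y) \<le> L * norm d"
    by (rule hess2_norm_le[OF C L(3) open_ball _ d]) (use L(1) in auto)
  then have "d \<noteq> 0" using \<open>g y \<noteq> 0\<close> by auto
  then show ?thesis using pd[OF _ d] by simp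
qed

lemma quotient_tendsto_zero:
  fixes a b :: "nat \<Rightarrow> real"
  assumes "\<And>k. a k \<ge> 0" "\<And>k. b k > 0" "\<And>\<epsilon>. \<epsilon> > 0 \<Longrightarrow> eventually (\<lambda>k. a k \<le> \<epsilon> * b k) sequentially"
  shows "(\<lambda>k. a k / b k) \<longlonglongrightarrow> 0"
proof (rule tendstoI)
  fix e :: real assume "e > 0"
  then have "eventually (\<lambda>k. a k \<le> e / 2 * b k) sequentially" by (intro assms(3)) simp
  then show "eventually (\<lambda>k. dist (a k / b k) 0 < e) sequentially"
  proof eventually_elim
    case (elim k)
    have "a k / b k \<le> e / 2" using elim assms(2)[of k] by (simp add: pos_divide_le_eq)
    then have "a k / b k < e" using \<open>e > 0\<close> by linarith
    then show ?case using assms(1,2)[of k] by simp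
  qed
qed

section \<open>Acceptance of full steps and transfer of rates to values and gradients\<close>

theorem theorem4p5:
  fixes \<phi> :: "'a::euclidean_space \<Rightarrow> real" and g :: "'a \<Rightarrow> 'a"
    and x :: "nat \<Rightarrow> 'a" and xb :: 'a and \<sigma> \<beta> lip_const :: real
  assumes C11: "C11 \<phi> g"
    and posdef: "\<forall>y. \<phi> y \<le> \<phi> (x 0) \<longrightarrow> (\<forall>u z. u \<noteq> 0 \<longrightarrow> z \<in> hess2 g y u \<longrightarrow> z \<bullet> u > 0)"
    and sigma: "0 < \<sigma>" "\<sigma> < 1/2"
    and beta: "0 < \<beta>" "\<beta> < 1"
    and alg: "gdna_seq \<phi> g \<sigma> \<beta> x"
    and conv: "x \<longlonglongrightarrow> xb" and neq: "\<forall>k. x k \<noteq> xb"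
    and ell: "lip_const > 0"
    and lip: "\<exists>\<delta>>0. \<forall>y\<in>ball xb \<delta>. \<forall>z\<in>ball xb \<delta>. norm (g y - g z) \<le> lip_const * norm (y - z)"
    and ss: "semismooth_star_fun g xb"
    and cases: "dir_differentiable g xb \<or>
                (\<exists>\<kappa>>0. tilt_modulus \<phi> xb \<kappa> \<and> \<sigma> < 1 / (2 * lip_const * \<kappa>))"
  shows "q_superlinear x xb \<and> q_superlinear (\<lambda>k. \<phi> (x k)) (\<phi> xb)
         \<and> q_superlinear (\<lambda>k. g (x k)) 0"
proof -
  obtain d j where gnz: "\<And>k. g (x k) \<noteq> 0" and d: "\<And>k. - g (x k) \<in> hess2 g (x k) (d k)"
    and arm: "\<And>k. armijo \<phi> g \<sigma> \<beta> (x k) (d k) (j k)"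
    and first: "\<And>k i. i < j k \<Longrightarrow> \<not> armijo \<phi> g \<sigma> \<beta> (x k) (d k) i"
    and step: "\<And>k. x (Suc k) = x k + (\<beta> ^ j k) *\<^sub>R d k"
    using alg unfolding gdna_seq_def by metis
  \<comment> \<open>Positive definiteness is known on the initial level set, so descent is first
    proved conditionally; induction then keeps all iterates in that set.\<close>
  have dec: "\<phi> (x (Suc k)) < \<phi> (x k)" if "\<phi> (x k) \<le> \<phi> (x 0)" for k
  proof -
    have "g (x k) \<bullet> d k < 0"
      by (rule hess2_newton_direction_descent[OF C11 _ d gnz]) (use posdef that in blast)
    then have "\<sigma> * \<beta> ^ j k * (g (x k) \<bullet> d k) < 0" using sigma beta by (simp add: mult_pos_neg)
    then show ?thesis using arm[of k] step[of k] by (simp add: armijo_def)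
  qed
  have le0: "\<phi> (x k) \<le> \<phi> (x 0)" for k by (induction k) (use dec in force)+
  have decs: "decseq (\<lambda>k. \<phi> (x k))" using dec[OF le0] by (intro decseq_SucI) (simp add: less_imp_le)
  have "isCont \<phi> xb" using C11_has_derivative[OF C11] has_derivative_continuous by blast
  then have phiconv: "(\<lambda>k. \<phi> (x k)) \<longlonglongrightarrow> \<phi> xb" using conv isCont_tendsto_compose by blast
  have phigt: "\<phi> xb < \<phi> (x k)" for k
    using decseq_ge[OF decs phiconv, of "Suc k"] dec[OF le0, of k] by simp
  have "\<phi> xb \<le> \<phi> (x 0)" using phigt[of 0] by simp
  then obtain c r where c: "c > 0" and r: "r > 0" and
    pd: "\<And>y w \<zeta>. y \<in> ball xb r \<Longrightarrow> reg_subgrad (\<lambda>x. w \<bullet> g x) y \<zeta> \<Longrightarrow> \<zeta> \<bullet> w \<ge> c * (norm w)\<^sup>2"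
    using hess2_posdef_imp_uniform[OF C11, of xb] posdef by metis
  have g0: "g xb = 0"
    using damped_newton_limit_stationary[OF C11 conv _ beta c r pd d first step] sigma by simp
  obtain \<delta> where \<delta>: "\<delta> > 0" "\<And>y z. y \<in> ball xb \<delta> \<Longrightarrow> z \<in> ball xb \<delta> \<Longrightarrow> norm (g y - g z) \<le> lip_const * norm (y - z)"
    using lip by blast
  define S where "S = ball xb (min r \<delta>)"
  have S: "open S" "convex S" "xb \<in> S" "S \<subseteq> ball xb \<delta>" "S \<subseteq> ball xb r" using \<delta>(1) r by (auto simp: S_def)
  have lipS: "norm (g y - g z) \<le> lip_const * norm (y - z)" if "y \<in> S" "z \<in> S" for y z
    using \<delta>(2) that S(4) by blast
  have gup: "norm (g y) \<le> lip_const * norm (y - xb)" if "y \<in> S" for y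
    using lipS[OF that S(3)] g0 by simp
  have pdS: "\<zeta> \<bullet> w \<ge> c * (norm w)\<^sup>2" if "y \<in> S" "reg_subgrad (\<lambda>x. w \<bullet> g x) y \<zeta>" for y w \<zeta>
    using pd that S(5) by blast
  have mono: "c * (norm (y - xb))\<^sup>2 \<le> g y \<bullet> (y - xb)" if "y \<in> S" for y
    using strongly_monotone_if_reg_subgrad_ge[OF C11 S(1,2) that S(3) pdS] g0 by simp
  have glow: "c * norm (y - xb) \<le> norm (g y)" if "y \<in> S" for y
  proof (cases "y = xb")
    case False
    have "c * norm (y - xb) * norm (y - xb) \<le> norm (g y) * norm (y - xb)"
      using mono[OF that] norm_cauchy_schwarz[of "g y" "y - xb"] by (simp add: power2_eq_square mult.assoc)
    then show ?thesis using False by simp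
  qed simp
  have seg: "xb + \<theta> *\<^sub>R (y - xb) \<in> S" if "y \<in> S" "0 < \<theta>" "\<theta> < 1" for y \<theta>
    using convexD_alt[OF S(2,3) that(1), of \<theta>] that by (simp add: algebra_simps)
  have phiup: "\<phi> y - \<phi> xb \<le> lip_const * (norm (y - xb))\<^sup>2" if "y \<in> S" for y
    using C11_descent[OF C11 S(2,3) _ lipS ell, of "y - xb"] that g0 by simp
  \<comment> \<open>With \<open>q\<close> the monotonicity bound, strong monotonicity between
    \<open>xb\<close> and the intermediate point makes the right-hand side of the quadratic mean
    value identity nonnegative.\<close>
  have philow: "c / 2 * (norm (y - xb))\<^sup>2 \<le> \<phi> y - \<phi> xb" if y: "y \<in> S" for y
  proof -
    define q where "q = c * (norm (y - xb))\<^sup>2"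
    obtain \<theta> where t: "0 < \<theta>" "\<theta> < 1"
      "\<phi> (xb + (y - xb)) - \<phi> xb - q / 2 = g (xb + \<theta> *\<^sub>R (y - xb)) \<bullet> (y - xb) - \<theta> * q"
      by (rule C11_mvt_quadratic[OF C11])
    have "\<theta> * (\<theta> * q) \<le> \<theta> * (g (xb + \<theta> *\<^sub>R (y - xb)) \<bullet> (y - xb))"
      using mono[OF seg[OF y t(1,2)]] t by (simp add: q_def power2_eq_square mult.assoc mult.left_commute)
    then have "\<theta> * q \<le> g (xb + \<theta> *\<^sub>R (y - xb)) \<bullet> (y - xb)" using t by simp
    then show ?thesis using t(3) by (simp add: q_def)
  qed
  \<comment> \<open>This is the Armijo test for the exact step \<open>xb - y\<close>, with slack
    \<open>\<mu> * (norm (y - xb))\<^sup>2\<close> to absorb the deviation of the Newton step from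
    it.\<close>
  have "\<exists>\<mu>>0. eventually (\<lambda>y. \<sigma> * (g y \<bullet> (y - xb)) + \<mu> * (norm (y - xb))\<^sup>2 \<le> \<phi> y - \<phi> xb) (nhds xb)"
    using cases
  proof
    assume dd: "dir_differentiable g xb"
    \<comment> \<open>Half of the gain \<open>(1 / 2 - \<sigma>) * c\<close> becomes the slack; the
      other half absorbs the error of the directional approximation.\<close>
    define \<mu> where "\<mu> = (1 / 2 - \<sigma>) * c / 2"
    have \<mu>: "\<mu> > 0" using sigma c by (simp add: \<mu>_def)
    obtain r1 where r1: "r1 > 0" "\<And>h s. norm h < r1 \<Longrightarrow> 0 < s \<Longrightarrow> s < 1
        \<Longrightarrow> norm (g (xb + s *\<^sub>R h) - s *\<^sub>R g (xb + h)) \<le> \<mu> * norm h"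
      using dir_differentiable_imp_uniform[OF C11 dd g0 \<mu>] by metis
    have "eventually (\<lambda>y. y \<in> S \<inter> ball xb r1) (nhds xb)"
      using S r1(1) by (intro eventually_nhds_in_open) auto
    then have "eventually (\<lambda>y. \<sigma> * (g y \<bullet> (y - xb)) + \<mu> * (norm (y - xb))\<^sup>2 \<le> \<phi> y - \<phi> xb) (nhds xb)"
    proof eventually_elim
      case (elim y)
      define h where "h = y - xb"
      have y: "y = xb + h" "norm h < r1" "y \<in> S" using elim by (auto simp: h_def dist_norm norm_minus_commute)
      define q where "q = g y \<bullet> h"
      obtain \<theta> where t: "0 < \<theta>" "\<theta> < 1" "\<phi> (xb + h) - \<phi> xb - q / 2 = g (xb + \<theta> *\<^sub>R h) \<bullet> h - \<theta> * q"
        by (rule C11_mvt_quadratic[OF C11])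
      have "- (norm (g (xb + \<theta> *\<^sub>R h) - \<theta> *\<^sub>R g (xb + h)) * norm h) \<le> (g (xb + \<theta> *\<^sub>R h) - \<theta> *\<^sub>R g (xb + h)) \<bullet> h"
        using Cauchy_Schwarz_ineq2[of "g (xb + \<theta> *\<^sub>R h) - \<theta> *\<^sub>R g (xb + h)" h] by linarith
      moreover have "norm (g (xb + \<theta> *\<^sub>R h) - \<theta> *\<^sub>R g (xb + h)) * norm h \<le> \<mu> * norm h * norm h"
        using r1(2)[OF y(2) t(1,2)] by (intro mult_right_mono) auto
      ultimately have 1: "- (\<mu> * (norm h)\<^sup>2) \<le> \<phi> y - \<phi> xb - q / 2"
        using t(3) y(1) by (simp add: q_def inner_diff_left power2_eq_square)
      have "(1 / 2 - \<sigma>) * (c * (norm h)\<^sup>2) \<le> (1 / 2 - \<sigma>) * q"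
        using mono[OF y(3)] sigma by (intro mult_left_mono) (auto simp: q_def h_def)
      moreover have "(1 / 2 - \<sigma>) * (c * (norm h)\<^sup>2) = \<mu> * (norm h)\<^sup>2 + \<mu> * (norm h)\<^sup>2"
        by (simp add: \<mu>_def)
      moreover have "(1 / 2 - \<sigma>) * q = q / 2 - \<sigma> * q" by (simp add: algebra_simps)
      ultimately show ?case using 1 unfolding q_def h_def by linarith
    qed
    then show ?thesis using \<mu> by blast
  next
    assume "\<exists>\<kappa>>0. tilt_modulus \<phi> xb \<kappa> \<and> \<sigma> < 1 / (2 * lip_const * \<kappa>)"
    then obtain \<kappa> where k: "\<kappa> > 0" "tilt_modulus \<phi> xb \<kappa>" "\<sigma> < 1 / (2 * lip_const * \<kappa>)" by blast
    \<comment> \<open>Growth rate minus the largest slope contribution; positivity is precisely the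
      bound on \<open>\<sigma>\<close>.\<close>
    define \<mu> where "\<mu> = 1 / (2 * \<kappa>) - \<sigma> * lip_const"
    have \<mu>: "\<mu> > 0" using k ell by (simp add: \<mu>_def field_simps)
    obtain r1 where r1: "r1 > 0" "\<And>y. y \<in> ball xb r1 \<Longrightarrow> \<phi> y \<ge> \<phi> xb + (norm (y - xb))\<^sup>2 / (2 * \<kappa>)"
      using tilt_modulus_quadratic_growth[OF k(2,1)] by metis
    have "eventually (\<lambda>y. y \<in> S \<inter> ball xb r1) (nhds xb)"
      using S r1(1) by (intro eventually_nhds_in_open) auto
    then have "eventually (\<lambda>y. \<sigma> * (g y \<bullet> (y - xb)) + \<mu> * (norm (y - xb))\<^sup>2 \<le> \<phi> y - \<phi> xb) (nhds xb)"
    proof eventually_elim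
      case (elim y)
      have "g y \<bullet> (y - xb) \<le> norm (g y) * norm (y - xb)" by (rule norm_cauchy_schwarz)
      also have "\<dots> \<le> lip_const * norm (y - xb) * norm (y - xb)"
        using gup elim by (intro mult_right_mono) auto
      finally have "\<sigma> * (g y \<bullet> (y - xb)) \<le> \<sigma> * (lip_const * (norm (y - xb))\<^sup>2)"
        using sigma by (simp add: power2_eq_square mult.assoc)
      then have "\<sigma> * (g y \<bullet> (y - xb)) + \<mu> * (norm (y - xb))\<^sup>2 \<le> (norm (y - xb))\<^sup>2 / (2 * \<kappa>)"
        by (simp add: \<mu>_def algebra_simps)
      also have "\<dots> \<le> \<phi> y - \<phi> xb" using r1(2)[of y] elim by simp
      finally show ?case .
    qed
    then show ?thesis using \<mu> by blast
  qed
  then obtain \<mu> where \<mu>: "\<mu> > 0"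
    "eventually (\<lambda>y. \<sigma> * (g y \<bullet> (y - xb)) + \<mu> * (norm (y - xb))\<^sup>2 \<le> \<phi> y - \<phi> xb) (nhds xb)" by blast
  define e where "e k = norm (x k - xb)" for k
  have epos: "e k > 0" for k using neq by (simp add: e_def)
  have evS: "eventually (\<lambda>k. x k \<in> S) sequentially" using conv S by (intro topological_tendstoD)
  have ev\<mu>: "eventually (\<lambda>k. \<sigma> * (g (x k) \<bullet> (x k - xb)) + \<mu> * (e k)\<^sup>2 \<le> \<phi> (x k) - \<phi> xb) sequentially"
    unfolding e_def using eventually_compose_filterlim[OF \<mu>(2) conv] .
  have newton: "eventually (\<lambda>k. norm (x k + d k - xb) \<le> \<epsilon> * e k) sequentially" if "\<epsilon> > 0" for \<epsilon>
  proof -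
    have ce: "c * \<epsilon> > 0" using c that by simp
    obtain r1 where r1: "r1 > 0" "\<And>y w \<zeta>. y \<in> ball xb r1 \<Longrightarrow> reg_subgrad (\<lambda>x. w \<bullet> g x) y \<zeta>
      \<Longrightarrow> \<bar>\<zeta> \<bullet> (y - xb) - w \<bullet> (g y - g xb)\<bar> \<le> (c * \<epsilon>) * norm (y - xb) * norm w"
      using semismooth_star_imp_uniform[OF C11 ss ce] by metis
    have "eventually (\<lambda>k. x k \<in> ball xb (min r r1)) sequentially"
      using conv r r1(1) by (intro topological_tendstoD) auto
    then show ?thesis
    proof eventually_elim
      case (elim k)
      have "c * norm (x k + d k - xb) \<le> (c * \<epsilon>) * norm (x k - xb)"
        by (rule newton_step_error_le[OF C11 g0 _ _ elim d ce]) (use pd r1 in auto)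
      then show ?case using c by (simp add: e_def mult.assoc)
    qed
  qed
  have unit: "eventually (\<lambda>k. j k = 0) sequentially"
  proof -
    \<comment> \<open>The errors in \<open>\<phi> (x k + d k)\<close> and in
      \<open>\<sigma> * (g (x k) \<bullet> d k)\<close> are each at most
      \<open>lip_const * \<epsilon> * (e k)\<^sup>2\<close>, so together they fit into the slack.
      The bound 1 keeps the trial point in \<open>S\<close> and reduces the square of
      \<open>\<epsilon>\<close> to its first power.\<close>
    define \<epsilon> where "\<epsilon> = min 1 (\<mu> / (2 * lip_const))"
    have \<epsilon>: "\<epsilon> > 0" "\<epsilon> \<le> 1" "2 * lip_const * \<epsilon> \<le> \<mu>"
      using \<mu>(1) ell by (auto simp: \<epsilon>_def min_def field_simps)
    have "(\<lambda>k. e k) \<longlonglongrightarrow> norm (xb - xb)" unfolding e_def by (intro tendsto_intros conv)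
    then have "eventually (\<lambda>k. e k < min r \<delta>) sequentially"
      using r \<delta>(1) by (intro order_tendstoD) auto
    with newton[OF \<epsilon>(1)] evS ev\<mu> show ?thesis
    proof eventually_elim
      case (elim k)
      define w where "w = x k + d k - xb"
      have w: "norm w \<le> \<epsilon> * e k" using elim by (simp add: w_def)
      also have "\<dots> \<le> 1 * e k" using \<epsilon> epos[of k] by (intro mult_right_mono) auto
      finally have "norm w \<le> e k" by simp
      then have xd: "x k + d k \<in> S" using elim(4) by (simp add: S_def w_def dist_norm norm_minus_commute)
      have "(norm w)\<^sup>2 \<le> (\<epsilon> * e k) * (1 * e k)"
        using w \<open>norm w \<le> e k\<close> epos[of k] \<epsilon> unfolding power2_eq_square by (intro mult_mono) auto
      then have w2: "lip_const * (norm w)\<^sup>2 \<le> lip_const * (\<epsilon> * (e k)\<^sup>2)"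
        using ell by (simp add: power2_eq_square mult.assoc)
      have 1: "\<phi> (x k + d k) - \<phi> xb \<le> lip_const * (\<epsilon> * (e k)\<^sup>2)"
        using phiup[OF xd] w2 by (simp add: w_def)
      have "- (g (x k) \<bullet> w) \<le> norm (g (x k)) * norm w"
        using Cauchy_Schwarz_ineq2[of "g (x k)" w] by linarith
      also have "\<dots> \<le> (lip_const * e k) * (\<epsilon> * e k)"
        using gup[OF elim(2)] w ell epos[of k] by (intro mult_mono) (auto simp: e_def)
      finally have 2: "- (g (x k) \<bullet> w) \<le> lip_const * (\<epsilon> * (e k)\<^sup>2)" by (simp add: power2_eq_square algebra_simps)
      then have "\<sigma> * (- (g (x k) \<bullet> w)) \<le> \<sigma> * (lip_const * (\<epsilon> * (e k)\<^sup>2))"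
        using sigma by (intro mult_left_mono) auto
      also have "\<dots> \<le> 1 * (lip_const * (\<epsilon> * (e k)\<^sup>2))"
        using sigma ell \<epsilon> by (intro mult_right_mono) auto
      finally have 3: "- (\<sigma> * (g (x k) \<bullet> w)) \<le> lip_const * (\<epsilon> * (e k)\<^sup>2)" by simp
      have "2 * lip_const * \<epsilon> * (e k)\<^sup>2 \<le> \<mu> * (e k)\<^sup>2" using \<epsilon>(3) by (intro mult_right_mono) auto
      then have 4: "lip_const * (\<epsilon> * (e k)\<^sup>2) + lip_const * (\<epsilon> * (e k)\<^sup>2) \<le> \<mu> * (e k)\<^sup>2" by (simp add: algebra_simps)
      have "\<sigma> * (g (x k) \<bullet> d k) = \<sigma> * (g (x k) \<bullet> w) - \<sigma> * (g (x k) \<bullet> (x k - xb))"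
        by (simp add: w_def algebra_simps)
      then have "\<phi> (x k + d k) \<le> \<phi> (x k) + \<sigma> * (g (x k) \<bullet> d k)"
        using 1 3 4 elim(3) by linarith
      then have "armijo \<phi> g \<sigma> \<beta> (x k) (d k) 0" by (simp add: armijo_def)
      then show ?case using first[of 0 k] by auto
    qed
  qed
  have sup: "eventually (\<lambda>k. e (Suc k) \<le> \<epsilon> * e k) sequentially" if "\<epsilon> > 0" for \<epsilon>
    using newton[OF that] unit by eventually_elim (simp add: e_def step)
  have evS': "eventually (\<lambda>k. x (Suc k) \<in> S) sequentially"
    using LIMSEQ_Suc[OF conv] S(1,3) by (intro topological_tendstoD)
  have "q_superlinear x xb"
    unfolding q_superlinear_def
    using conv neq quotient_tendsto_zero[of "\<lambda>k. e (Suc k)" e] sup epos by (simp add: e_def)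
  moreover have "q_superlinear (\<lambda>k. g (x k)) 0"
  proof -
    have "(\<lambda>k. norm (g (x (Suc k))) / norm (g (x k))) \<longlonglongrightarrow> 0"
    proof (rule quotient_tendsto_zero)
      fix \<epsilon> :: real assume "\<epsilon> > 0"
      \<comment> \<open>Near \<open>xb\<close> the gradient norm lies between \<open>c * e k\<close>
        and \<open>lip_const * e k\<close>, so the distance rate transfers with this
        tolerance.\<close>
      then have "\<epsilon> * c / lip_const > 0" using c ell by simp
      from sup[OF this] evS evS'
      show "eventually (\<lambda>k. norm (g (x (Suc k))) \<le> \<epsilon> * norm (g (x k))) sequentially"
      proof eventually_elim
        case (elim k)
        have "norm (g (x (Suc k))) \<le> lip_const * e (Suc k)" using gup[OF elim(3)] by (simp add: e_def)
        also have "\<dots> \<le> lip_const * (\<epsilon> * c / lip_const * e k)" using elim(1) ell by (intro mult_left_mono) auto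
        also have "\<dots> = \<epsilon> * (c * e k)" using ell by simp
        also have "\<dots> \<le> \<epsilon> * norm (g (x k))"
          using glow[OF elim(2)] \<open>\<epsilon> > 0\<close> by (intro mult_left_mono) (auto simp: e_def)
        finally show ?case .
      qed
    qed (use gnz in auto)
    then show ?thesis
      unfolding q_superlinear_def using gnz C11_tendsto_gradient[OF C11 conv] g0 by simp
  qed
  moreover have "q_superlinear (\<lambda>k. \<phi> (x k)) (\<phi> xb)"
  proof -
    have "(\<lambda>k. norm (\<phi> (x (Suc k)) - \<phi> xb) / norm (\<phi> (x k) - \<phi> xb)) \<longlonglongrightarrow> 0"
    proof (rule quotient_tendsto_zero)
      fix \<epsilon> :: real assume "\<epsilon> > 0"
      \<comment> \<open>The excess of \<open>\<phi>\<close> lies between \<open>c / 2\<close> and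
        \<open>lip_const\<close> times the squared distance; \<open>\<eta> \<le> 1\<close> allows
        the squared rate to be replaced by \<open>\<eta>\<close>.\<close>
      define \<eta> where "\<eta> = min 1 (\<epsilon> * c / (2 * lip_const))"
      have \<eta>: "\<eta> > 0" "\<eta> \<le> 1" "lip_const * \<eta> \<le> \<epsilon> * (c / 2)"
        using c ell \<open>\<epsilon> > 0\<close> by (auto simp: \<eta>_def min_def field_simps)
      from sup[OF \<eta>(1)] evS evS'
      show "eventually (\<lambda>k. norm (\<phi> (x (Suc k)) - \<phi> xb) \<le> \<epsilon> * norm (\<phi> (x k) - \<phi> xb)) sequentially"
      proof eventually_elim
        case (elim k)
        have "\<eta> * e k \<le> 1 * e k" using \<eta> epos[of k] by (intro mult_right_mono) auto
        then have "e (Suc k) \<le> e k" using elim(1) by simp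
        then have "(e (Suc k))\<^sup>2 \<le> (\<eta> * e k) * (1 * e k)"
          using elim(1) epos[of k] epos[of "Suc k"] \<eta> unfolding power2_eq_square by (intro mult_mono) auto
        then have e2: "(e (Suc k))\<^sup>2 \<le> \<eta> * (e k)\<^sup>2" by (simp add: power2_eq_square mult.assoc)
        have "\<phi> (x (Suc k)) - \<phi> xb \<le> lip_const * (e (Suc k))\<^sup>2" using phiup[OF elim(3)] by (simp add: e_def)
        also have "\<dots> \<le> lip_const * (\<eta> * (e k)\<^sup>2)" using e2 ell by (intro mult_left_mono) auto
        also have "\<dots> = (lip_const * \<eta>) * (e k)\<^sup>2" by simp
        also have "\<dots> \<le> (\<epsilon> * (c / 2)) * (e k)\<^sup>2" using \<eta>(3) by (intro mult_right_mono) auto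
        also have "\<dots> = \<epsilon> * (c / 2 * (e k)\<^sup>2)" by simp
        also have "\<dots> \<le> \<epsilon> * (\<phi> (x k) - \<phi> xb)"
          using philow[OF elim(2)] \<open>\<epsilon> > 0\<close> by (intro mult_left_mono) (auto simp: e_def)
        finally show ?case using phigt[of k] phigt[of "Suc k"] by simp
      qed
    qed (use phigt in \<open>auto simp: less_imp_neq[symmetric]\<close>)
    then show ?thesis
      unfolding q_superlinear_def using phiconv phigt by (metis less_irrefl)
  qed
  ultimately show ?thesis by blast
qed

end
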